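(* For $1\le p,q<\infty$ and an integer $n\ge1$, let $A(p,q,n)$ and $B(p,q,n)$ be the best constants (largest $A$, smallest $B$) such that for every $(a_1,\ldots,a_n)\in\mathbb{R}^n$, $$A(p,q,n)\left(\sum_{i=1}^na_i^2\right)^{1/2}\le\left(\frac{1}{\mathrm{vol}(B_p^n)}\int_{B_p^n}\left|\sum_{i=1}^na_ix_i\right|^q dx\right)^{1/q}\le B(p,q,n)\left(\sum_{i=1}^na_i^2\right)^{1/2}.$$ Then for every integer $n\ge1$ and every $1\le q<\infty$ and $1\le p\le2$, $$A(p,q,n)\sim\frac{\sqrt q}{n^{1/p}}\min\left\{1,\sqrt{\frac nq}\right\}\quad\text{and}\quad B(p,q,n)\sim\min\left\{1,\left(\frac qn\right)^{1/p}\right\},$$ while for $2<p<\infty$, $$A(p,q,n)\sim\min\left\{1,\left(\frac qn\right)^{1/p}\right\}\quad\text{and}\quad B(p,q,n)\sim\frac{\sqrt q}{n^{1/p}}\min\left\{1,\sqrt{\frac nq}\right\}.$$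
   Context: $B_p^n=\{x\in\mathbb{R}^n:\sum_{i=1}^n|x_i|^p\le1\}$ and $\mathrm{vol}$ is Lebesgue measure. The notation $a\sim b$ for positive quantities depending on parameters means that there are absolute numerical constants $c,C>0$ (independent of all parameters $p,q,n$) such that $ca\le b\le Ca$ for all values of the parameters. *)

theory Defs
  imports "HOL-Analysis.Analysis"
begin

(* The absolute constants must not depend on the dimension, so n has to be an ordinary
   variable: R^n is {..<n} \<rightarrow>\<^sub>E UNIV (functions that are undefined outside {..<n}), the space
   of the product of n copies of lborel, and that product is Lebesgue measure on R^n. *)

definition lebesgue_n :: "nat \<Rightarrow> (nat \<Rightarrow> real) measure" where
  "lebesgue_n n = (\<Pi>\<^sub>M i\<in>{..<n}. lborel)"

definition lp_ball :: "real \<Rightarrow> nat \<Rightarrow> (nat \<Rightarrow> real) set" where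
  "lp_ball p n = {x \<in> {..<n} \<rightarrow>\<^sub>E UNIV. (\<Sum>i<n. \<bar>x i\<bar> powr p) \<le> 1}"

definition Lq_norm_lp_ball :: "real \<Rightarrow> real \<Rightarrow> nat \<Rightarrow> (nat \<Rightarrow> real) \<Rightarrow> real" where
  "Lq_norm_lp_ball p q n a =
     (1 / measure (lebesgue_n n) (lp_ball p n) *
      (LINT x:lp_ball p n|lebesgue_n n. \<bar>\<Sum>i<n. a i * x i\<bar> powr q)) powr (1 / q)"

definition best_lower :: "real \<Rightarrow> real \<Rightarrow> nat \<Rightarrow> real" where
  "best_lower p q n =
     (GREATEST A. \<forall>a. A * sqrt (\<Sum>i<n. (a i)\<^sup>2) \<le> Lq_norm_lp_ball p q n a)"

definition best_upper :: "real \<Rightarrow> real \<Rightarrow> nat \<Rightarrow> real" where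
  "best_upper p q n =
     (LEAST B. \<forall>a. Lq_norm_lp_ball p q n a \<le> B * sqrt (\<Sum>i<n. (a i)\<^sup>2))"

(* f ~ g, uniformly over all parameter values in S. *)
definition sim_on :: "'t set \<Rightarrow> ('t \<Rightarrow> real) \<Rightarrow> ('t \<Rightarrow> real) \<Rightarrow> bool" where
  "sim_on S f g \<longleftrightarrow> (\<exists>c>0. \<exists>C>0. \<forall>t\<in>S. c * f t \<le> g t \<and> g t \<le> C * f t)"

end

theory Submission
  imports Defs "HOL-Probability.Probability"
begin

text \<open>
  Let \<open>g\<^sub>1, g\<^sub>2, \<dots>\<close> be independent with density proportional to \<open>exp (- |t|\<^sup>p)\<close>. Integrating a homogeneous
  function against \<open>exp (- \<Sum>|x\<^sub>i|\<^sup>p)\<close> slice by slice turns the moment of order \<open>2k\<close> of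
  \<open>\<Sum>a\<^sub>i x\<^sub>i\<close> on the ball into the one of \<open>\<Sum>a\<^sub>i g\<^sub>i\<close>, up to the factor
  \<open>\<Gamma>(n/p + 1) / \<Gamma>((n + 2k)/p + 1)\<close>, whose \<open>2k\<close>-th root is of order \<open>n\<^sup>-\<^sup>1\<^sup>/\<^sup>p\<close> for \<open>k \<le> n\<close>.
  Since odd moments vanish, the even moments divided by \<open>(2k)!\<close> are convolved when independent
  summands are added. Hence \<open>E g\<^sup>2\<^sup>j \<le> D\<^sup>j (2j)!/j!\<close> for \<open>j \<le> k\<close> passes on to
  \<open>E (\<Sum>a\<^sub>i g\<^sub>i)\<^sup>2\<^sup>k \<le> (D |a|\<^sup>2)\<^sup>k (2k)!/k!\<close>, and likewise from below. As \<open>E g\<^sup>2\<^sup>j\<close> is of order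
  \<open>j\<^sup>2\<^sup>j\<^sup>/\<^sup>p\<close>, these bounds put the normalised norm between \<open>t\<^sup>e n\<^sup>-\<^sup>1\<^sup>/\<^sup>p\<close> with \<open>e = min (1/2) (1/p)\<close>
  and with \<open>e = max (1/2) (1/p)\<close>, where \<open>t = min q n\<close>. The vector \<open>(1, \<dots>, 1)\<close>
  attains the exponent \<open>1/2\<close> and the first unit vector the exponent \<open>1/p\<close>. For \<open>q > n\<close> the upper bounds are
  pointwise bounds on the ball; other exponents \<open>q\<close> are compared with neighbouring even ones.
\<close>

section \<open>Estimates for the Gamma function\<close>

text \<open>By the functional equation \<open>ln_Gamma\<close> grows by \<open>ln x\<close> between
  \<open>x\<close> and \<open>x + 1\<close>. By the mean value theorem this increment is
  \<open>Digamma z\<close> for an intermediate \<open>z\<close>, and \<open>Digamma\<close> is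
  increasing.\<close>

lemma Digamma_le_ln:
  fixes x :: real assumes "x > 0"
  shows "Digamma x \<le> ln x" and "ln x \<le> Digamma (x + 1)"
proof -
  have "\<exists>z>x. z < x + 1 \<and> ln_Gamma (x + 1) - ln_Gamma x = (x + 1 - x) * Digamma z"
    using assms by (intro MVT2 has_field_derivative_ln_Gamma_real) auto
  then obtain z where z: "x < z" "z < x + 1" "ln_Gamma (x + 1) - ln_Gamma x = Digamma z"
    by auto
  have "ln_Gamma (x + 1) = ln x + ln_Gamma x"
  proof -
    have "x \<notin> \<int>\<^sub>\<le>\<^sub>0" using assms nonpos_Ints_nonpos[of x] by auto
    then have "Gamma (x + 1) = x * Gamma x" by (rule Gamma_plus1)
    moreover have "Gamma x \<noteq> 0" using Gamma_real_pos[OF assms] by linarith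
    ultimately show ?thesis using assms by (simp add: ln_Gamma_real_pos ln_mult)
  qed
  then have "Digamma z = ln x" using z by simp
  then show "Digamma x \<le> ln x" "ln x \<le> Digamma (x + 1)"
    using Digamma_real_mono[of x z] Digamma_real_mono[of z "x + 1"] z assms by auto
qed

text \<open>A substitute for Stirling's formula with a real increment: by the mean value theorem the
  increment of \<open>ln_Gamma\<close> is \<open>s * Digamma z\<close> with
  \<open>x < z < x + s\<close>, and \<open>Digamma z\<close> lies between \<open>ln x - 1\<close>
  and \<open>ln (x + s)\<close>.\<close>

lemma Gamma_add_bounds:
  fixes x s :: real assumes "x \<ge> 1" "s \<ge> 0"
  shows "(x / exp 1) powr s * Gamma x \<le> Gamma (x + s)"
    and "Gamma (x + s) \<le> (x + s) powr s * Gamma x"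
proof -
  have "(x / exp 1) powr s * Gamma x \<le> Gamma (x + s) \<and> Gamma (x + s) \<le> (x + s) powr s * Gamma x"
  proof (cases "s = 0")
    case True
    then show ?thesis using assms by simp
  next
    case False
    then have "s > 0" using assms by simp
    then have "\<exists>z>x. z < x + s \<and> ln_Gamma (x + s) - ln_Gamma x = (x + s - x) * Digamma z"
      using assms by (intro MVT2 has_field_derivative_ln_Gamma_real) auto
    then obtain z where z: "x < z" "z < x + s" "ln_Gamma (x + s) - ln_Gamma x = s * Digamma z"
      by auto
    have "Digamma z \<le> ln z" using Digamma_le_ln(1)[of z] z assms by simp
    also have "\<dots> \<le> ln (x + s)" using z assms by simp
    finally have up: "Digamma z \<le> ln (x + s)" .
    \<comment> \<open>Moving from \<open>x + 1\<close> back to \<open>x\<close> costs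
      \<open>1 / x \<le> 1\<close>; this is the origin of the factor \<open>exp 1\<close>.\<close>
    have "ln x \<le> Digamma (x + 1)" using Digamma_le_ln(2)[of x] assms by simp
    also have "\<dots> = Digamma x + 1 / x" using Digamma_plus1[of x] assms by simp
    also have "\<dots> \<le> Digamma z + 1"
      using Digamma_real_mono[of x z] z assms by (intro add_mono) auto
    finally have lo: "ln (x / exp 1) \<le> Digamma z"
      using assms by (simp add: ln_div)
    have eq: "Gamma (x + s) = exp (s * Digamma z) * Gamma x"
      using z(3) assms by (simp add: Gamma_real_pos_exp exp_add[symmetric] algebra_simps)
    have "(x / exp 1) powr s = exp (s * ln (x / exp 1))" "(x + s) powr s = exp (s * ln (x + s))"
      using assms by (simp_all add: powr_def)
    moreover have "exp (s * ln (x / exp 1)) \<le> exp (s * Digamma z)"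
      "exp (s * Digamma z) \<le> exp (s * ln (x + s))"
      using lo up \<open>s > 0\<close> by simp_all
    moreover have "Gamma x > 0" using assms by (simp add: Gamma_real_pos)
    ultimately show ?thesis unfolding eq by (intro conjI mult_right_mono) simp_all
  qed
  then show "(x / exp 1) powr s * Gamma x \<le> Gamma (x + s)"
    "Gamma (x + s) \<le> (x + s) powr s * Gamma x" by auto
qed

text \<open>Keep only the part \<open>t \<ge> y\<close> of the Gamma integral. There
  \<open>t powr y \<ge> y powr y\<close>, and the remaining integral of \<open>exp (- t)\<close> is
  \<open>exp (- y)\<close>.\<close>

lemma Gamma_plus1_ge:
  fixes y :: real assumes "y > 0"
  shows "(y / exp 1) powr y \<le> Gamma (y + 1)"
proof -
  have "((\<lambda>t. if t \<in> {y..} then y powr y * exp (- 1 * t) else 0) has_integral y powr y * (exp (- 1 * y) / 1)) {0..}"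
    using has_integral_mult_right[OF has_integral_exp_minus_to_infinity[of 1 y], of "y powr y"] assms
    by (subst has_integral_restrict) auto
  moreover have "((\<lambda>t. t powr y / exp t) has_integral Gamma (y + 1)) {0..}"
    using Gamma_integral_real[of "y + 1"] assms by simp
  ultimately have "y powr y * (exp (- 1 * y) / 1) \<le> Gamma (y + 1)"
    using assms by (rule_tac has_integral_le) (auto simp: exp_minus field_simps intro!: powr_mono2)
  then show ?thesis using assms
    by (simp add: powr_divide exp_minus powr_def[of "exp 1"] field_simps)
qed

text \<open>This makes later constants independent of \<open>p\<close>. It is the inequality
  \<open>ln u \<le> u - 1\<close> at \<open>u = p / 2\<close>, combined with
  \<open>ln 2 \<ge> 2 / 3\<close>.\<close>

lemma root_self_le_2:
  fixes p :: real assumes "p \<ge> 1"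
  shows "p powr (1 / p) \<le> 2"
proof -
  have "ln (p / 2) \<le> p / 2 - 1" using assms by (intro ln_le_minus_one) auto
  then have "ln p \<le> p / 2 - 1 + ln 2" using assms by (simp add: ln_div)
  also have "\<dots> \<le> p * ln 2"
    using ln2_ge_two_thirds assms mult_right_mono[of 1 p "ln 2 - 1/2"] by (simp add: algebra_simps)
  finally have "ln p / p \<le> ln 2" using assms by (simp add: field_simps)
  then have "exp (ln p / p) \<le> exp (ln 2)" by (subst exp_le_cancel_iff)
  then show ?thesis using assms by (simp add: powr_def)
qed

section \<open>Even moments of sums of independent variables\<close>

lemma sum_vanishing_odd:
  fixes f :: "nat \<Rightarrow> real" assumes "\<And>i. odd i \<Longrightarrow> f i = 0"
  shows "(\<Sum>i\<le>2 * k. f i) = (\<Sum>j\<le>k. f (2 * j))"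
  by (induction k) (simp_all add: assms)

text \<open>Coefficients in \<open>exp (x t) * exp (y t) = exp ((x + y) t)\<close>. Hence bounds of
  the form \<open>b ^ k / fact k\<close> are stable under convolution.\<close>

lemma exp_coeff_convolution:
  fixes x y :: real
  shows "(x + y) ^ k / fact k = (\<Sum>j\<le>k. x ^ j / fact j * (y ^ (k - j) / fact (k - j)))"
proof -
  have "(x + y) ^ k / fact k = (\<Sum>j\<le>k. of_nat (k choose j) * x ^ j * y ^ (k - j)) / fact k"
    by (simp add: binomial_ring)
  also have "\<dots> = (\<Sum>j\<le>k. x ^ j / fact j * (y ^ (k - j) / fact (k - j)))"
    unfolding sum_divide_distrib by (intro sum.cong) (auto simp: binomial_fact)
  finally show ?thesis .
qed

text \<open>Symmetry is required only as the vanishing of odd moments, which is the form that the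
  binomial expansion uses.\<close>

locale indep_symmetric = prob_space +
  fixes X :: "nat \<Rightarrow> 'a \<Rightarrow> real" and I :: "nat set"
  assumes indep: "indep_vars (\<lambda>_. borel) X I"
    and integrable_pow: "i \<in> I \<Longrightarrow> integrable M (\<lambda>\<omega>. X i \<omega> ^ k)"
    and odd_moment: "i \<in> I \<Longrightarrow> odd k \<Longrightarrow> expectation (\<lambda>\<omega>. X i \<omega> ^ k) = 0"
begin

text \<open>Formally the coefficient of \<open>t ^ (2 * k)\<close> in the moment generating function
  of the partial sum.\<close>

definition even_moment :: "nat set \<Rightarrow> nat \<Rightarrow> real" where
  "even_moment J k = expectation (\<lambda>\<omega>. (\<Sum>i\<in>J. X i \<omega>) ^ (2 * k)) / fact (2 * k)"

lemma even_moment_nonneg: "0 \<le> even_moment J k"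
  unfolding even_moment_def by (intro divide_nonneg_nonneg Bochner_Integration.integral_nonneg) auto

text \<open>Expand by the binomial theorem and factor each term, since the new variable is
  independent of the old sum. All powers of the old sum occur, so its integrability is assumed for
  every exponent.\<close>

lemma sum_pow_insert:
  assumes "finite J" "i \<notin> J" "insert i J \<subseteq> I"
    and int: "\<And>k. integrable M (\<lambda>\<omega>. (\<Sum>j\<in>J. X j \<omega>) ^ k)"
  shows "integrable M (\<lambda>\<omega>. (\<Sum>j\<in>insert i J. X j \<omega>) ^ k)"
    and "expectation (\<lambda>\<omega>. (\<Sum>j\<in>insert i J. X j \<omega>) ^ k) =
      (\<Sum>l\<le>k. of_nat (k choose l) * (expectation (\<lambda>\<omega>. X i \<omega> ^ l) *
         expectation (\<lambda>\<omega>. (\<Sum>j\<in>J. X j \<omega>) ^ (k - l))))"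
proof -
  have iv: "indep_var borel (X i) borel (\<lambda>\<omega>. \<Sum>j\<in>J. X j \<omega>)"
    using assms by (intro indep_vars_sum indep_vars_subset[OF indep]) auto
  have iv': "indep_var borel (\<lambda>\<omega>. X i \<omega> ^ l) borel (\<lambda>\<omega>. (\<Sum>j\<in>J. X j \<omega>) ^ m)" for l m
    using indep_var_compose[OF iv, of "\<lambda>x. x ^ l" borel "\<lambda>x. x ^ m" borel] by (simp add: comp_def)
  have i: "i \<in> I" using assms by auto
  have 1: "integrable M (\<lambda>\<omega>. X i \<omega> ^ l * (\<Sum>j\<in>J. X j \<omega>) ^ m)"
    "expectation (\<lambda>\<omega>. X i \<omega> ^ l * (\<Sum>j\<in>J. X j \<omega>) ^ m) =
     expectation (\<lambda>\<omega>. X i \<omega> ^ l) * expectation (\<lambda>\<omega>. (\<Sum>j\<in>J. X j \<omega>) ^ m)" for l m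
    using indep_var_integrable[OF iv' integrable_pow[OF i] int]
      indep_var_lebesgue_integral[OF iv' integrable_pow[OF i] int] by auto
  have eq: "(\<Sum>j\<in>insert i J. X j \<omega>) ^ k =
     (\<Sum>l\<le>k. of_nat (k choose l) * (X i \<omega> ^ l * (\<Sum>j\<in>J. X j \<omega>) ^ (k - l)))" for \<omega>
    using assms by (simp add: binomial_ring mult.assoc)
  show "integrable M (\<lambda>\<omega>. (\<Sum>j\<in>insert i J. X j \<omega>) ^ k)"
    unfolding eq by (intro Bochner_Integration.integrable_sum integrable_mult_right 1)
  show "expectation (\<lambda>\<omega>. (\<Sum>j\<in>insert i J. X j \<omega>) ^ k) =
      (\<Sum>l\<le>k. of_nat (k choose l) * (expectation (\<lambda>\<omega>. X i \<omega> ^ l) *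
         expectation (\<lambda>\<omega>. (\<Sum>j\<in>J. X j \<omega>) ^ (k - l))))"
    unfolding eq by (subst Bochner_Integration.integral_sum) (simp_all add: 1)
qed

lemma integrable_sum_pow:
  assumes "finite J" "J \<subseteq> I"
  shows "integrable M (\<lambda>\<omega>. (\<Sum>j\<in>J. X j \<omega>) ^ k)"
  using assms
proof (induction J arbitrary: k rule: finite_induct)
  case (insert i J)
  then show ?case by (intro sum_pow_insert) auto
qed simp

lemma even_moment_empty: "even_moment {} k = (if k = 0 then 1 else 0)"
  by (simp add: even_moment_def prob_space)

lemma even_moment_0: "even_moment J 0 = 1"
  by (simp add: even_moment_def prob_space)

text \<open>Only even indices survive in the binomial expansion because odd moments of
  \<open>X i\<close> vanish; the factorials in \<open>even_moment\<close> absorb the binomial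
  coefficients.\<close>

lemma even_moment_insert:
  assumes "finite J" "i \<notin> J" "insert i J \<subseteq> I"
  shows "even_moment (insert i J) k = (\<Sum>j\<le>k. even_moment {i} j * even_moment J (k - j))"
proof -
  have i: "i \<in> I" using assms by auto
  let ?f = "\<lambda>l. of_nat (2 * k choose l) * (expectation (\<lambda>\<omega>. X i \<omega> ^ l) *
         expectation (\<lambda>\<omega>. (\<Sum>j\<in>J. X j \<omega>) ^ (2 * k - l)))"
  have "expectation (\<lambda>\<omega>. (\<Sum>j\<in>insert i J. X j \<omega>) ^ (2 * k)) = (\<Sum>l\<le>2 * k. ?f l)"
    using assms by (intro sum_pow_insert(2) integrable_sum_pow) auto
  also have "\<dots> = (\<Sum>j\<le>k. ?f (2 * j))"
    by (rule sum_vanishing_odd) (simp add: odd_moment[OF i])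
  also have "\<dots> = (\<Sum>j\<le>k. fact (2 * k) * (even_moment {i} j * even_moment J (k - j)))"
  proof (rule sum.cong)
    fix j assume "j \<in> {..k}"
    then have "2 * j \<le> 2 * k" "2 * k - 2 * j = 2 * (k - j)" by auto
    then show "?f (2 * j) = fact (2 * k) * (even_moment {i} j * even_moment J (k - j))"
      by (simp add: even_moment_def binomial_fact)
  qed simp
  finally show ?thesis
    by (simp add: even_moment_def[of "insert i J"] sum_distrib_left[symmetric])
qed

text \<open>The sequence \<open>b ^ j / fact j\<close> is that of a centred Gaussian with variance
  \<open>2 * b\<close>, and convolution adds the parameters \<open>b\<close>. Only
  \<open>j \<le> k\<close> is asked for, so that \<open>b\<close> may be chosen depending on
  \<open>k\<close>.\<close>

lemma even_moment_le_gaussian: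
  assumes "finite J" "J \<subseteq> I" "\<And>i. 0 \<le> b i"
    and "\<And>i j. i \<in> J \<Longrightarrow> j \<le> k \<Longrightarrow> even_moment {i} j \<le> b i ^ j / fact j"
  shows "even_moment J k \<le> (\<Sum>i\<in>J. b i) ^ k / fact k"
  using assms
proof (induction J arbitrary: k rule: finite_induct)
  case empty
  then show ?case by (auto simp: even_moment_empty)
next
  case (insert i J)
  have "even_moment (insert i J) k = (\<Sum>j\<le>k. even_moment {i} j * even_moment J (k - j))"
    using insert by (intro even_moment_insert) auto
  also have "\<dots> \<le> (\<Sum>j\<le>k. b i ^ j / fact j * ((\<Sum>i\<in>J. b i) ^ (k - j) / fact (k - j)))"
    using insert by (intro sum_mono mult_mono even_moment_nonneg insert.IH) auto
  also have "\<dots> = (\<Sum>i\<in>insert i J. b i) ^ k / fact k"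
    using insert by (simp add: exp_coeff_convolution)
  finally show ?case .
qed

text \<open>The same induction with the inequalities reversed; the nonnegativity of all terms allows
  multiplying the lower bounds.\<close>

lemma even_moment_ge_gaussian:
  assumes "finite J" "J \<subseteq> I" "\<And>i. 0 \<le> b i"
    and "\<And>i j. i \<in> J \<Longrightarrow> j \<le> k \<Longrightarrow> b i ^ j / fact j \<le> even_moment {i} j"
  shows "(\<Sum>i\<in>J. b i) ^ k / fact k \<le> even_moment J k"
  using assms
proof (induction J arbitrary: k rule: finite_induct)
  case empty
  then show ?case by (cases k) (auto simp: even_moment_empty)
next
  case (insert i J)
  have "(\<Sum>i\<in>insert i J. b i) ^ k / fact k =
      (\<Sum>j\<le>k. b i ^ j / fact j * ((\<Sum>i\<in>J. b i) ^ (k - j) / fact (k - j)))"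
    using insert by (simp add: exp_coeff_convolution)
  also have "\<dots> \<le> (\<Sum>j\<le>k. even_moment {i} j * even_moment J (k - j))"
    using insert
    by (intro sum_mono mult_mono even_moment_nonneg insert.IH)
      (auto intro!: divide_nonneg_nonneg sum_nonneg zero_le_power)
  also have "\<dots> = even_moment (insert i J) k"
    using insert by (intro even_moment_insert[symmetric]) auto
  finally show ?case .
qed

text \<open>Each variable is dominated by the series \<open>1 / (1 - C t)\<close>. The binomial
  coefficient belongs to its power with exponent \<open>card J + 1\<close>, one factor more than
  there are variables; the induction step is the sum along a diagonal of Pascal's triangle.\<close>

lemma even_moment_le_geometric:
  assumes "finite J" "J \<subseteq> I" "0 \<le> C"
    and "\<And>i j. i \<in> J \<Longrightarrow> even_moment {i} j \<le> C ^ j"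
  shows "even_moment J k \<le> C ^ k * real (card J + k choose k)"
  using assms
proof (induction J arbitrary: k rule: finite_induct)
  case empty
  then show ?case by (auto simp: even_moment_empty)
next
  case (insert i J)
  have "even_moment (insert i J) k = (\<Sum>j\<le>k. even_moment {i} j * even_moment J (k - j))"
    using insert by (intro even_moment_insert) auto
  also have "\<dots> \<le> (\<Sum>j\<le>k. C ^ j * (C ^ (k - j) * real (card J + (k - j) choose (k - j))))"
    using insert by (intro sum_mono mult_mono even_moment_nonneg insert.IH) auto
  also have "\<dots> = (\<Sum>j\<le>k. C ^ k * real (card J + (k - j) choose (k - j)))"
    by (intro sum.cong refl) (simp add: mult.assoc[symmetric] power_add[symmetric])
  also have "\<dots> = C ^ k * real (\<Sum>j\<le>k. card J + (k - j) choose (k - j))"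
    by (simp add: sum_distrib_left)
  also have "(\<Sum>j\<le>k. card J + (k - j) choose (k - j)) = (\<Sum>j\<le>k. card J + j choose j)"
    using sum.nat_diff_reindex[of "\<lambda>j. card J + j choose j" "Suc k"]
    by (simp add: lessThan_Suc_atMost)
  also have "\<dots> = card (insert i J) + k choose k"
    using insert by (simp add: sum_choose_lower)
  finally show ?case .
qed

text \<open>Each generating series dominates \<open>1 + c t\<close> coefficientwise, and the product
  of these has the binomial coefficients of \<open>card J\<close>.\<close>

lemma even_moment_ge_choose:
  assumes "finite J" "J \<subseteq> I" "0 \<le> c"
    and "\<And>i. i \<in> J \<Longrightarrow> c \<le> even_moment {i} 1"
  shows "c ^ k * real (card J choose k) \<le> even_moment J k"
  using assms
proof (induction J arbitrary: k rule: finite_induct)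
  case empty
  then show ?case by (cases k) (auto simp: even_moment_empty)
next
  case (insert i J)
  have e: "even_moment (insert i J) k = (\<Sum>j\<le>k. even_moment {i} j * even_moment J (k - j))"
    using insert by (intro even_moment_insert) auto
  show ?case
  proof (cases k)
    case 0
    then show ?thesis by (simp add: even_moment_0)
  next
    case (Suc m)
    \<comment> \<open>Pascal's rule; its two terms correspond to \<open>j = 0\<close> and
      \<open>j = 1\<close> in the convolution, and all other terms are dropped.\<close>
    have "c ^ k * real (card (insert i J) choose k) =
      1 * (c ^ k * real (card J choose k)) + c * (c ^ (k - 1) * real (card J choose (k - 1)))"
      using insert Suc by (simp add: algebra_simps)
    also have "\<dots> \<le> even_moment {i} 0 * even_moment J (k - 0) + even_moment {i} 1 * even_moment J (k - 1)"
      using insert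
      by (intro add_mono mult_mono even_moment_nonneg)
        (auto simp: even_moment_0 intro!: insert.IH)
    also have "\<dots> = (\<Sum>j\<in>{0,1}. even_moment {i} j * even_moment J (k - j))" by simp
    also have "\<dots> \<le> (\<Sum>j\<le>k. even_moment {i} j * even_moment J (k - j))"
      using Suc by (intro sum_mono2 mult_nonneg_nonneg even_moment_nonneg) auto
    finally show ?thesis unfolding e .
  qed
qed

end

section \<open>Integrals over the ball and independent coordinates\<close>

lemma nn_integral_exp_tail:
  fixes s :: real
  shows "(\<integral>\<^sup>+t. ennreal (exp (- t)) * indicator {s..} t \<partial>lborel) = ennreal (exp (- s))"
proof -
  have "((\<lambda>t::real. exp (- 1 * t)) has_integral exp (- 1 * s) / 1) {s..}"
    by (rule has_integral_exp_minus_to_infinity) simp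
  then show ?thesis by (intro nn_integral_has_integral_lebesgue') auto
qed

lemma nn_integral_Gamma:
  fixes d :: real assumes "d \<ge> 0"
  shows "(\<integral>\<^sup>+t. ennreal (t powr d * exp (- t)) * indicator {0..} t \<partial>lborel) = ennreal (Gamma (d + 1))"
proof -
  have "((\<lambda>t. t powr d * exp (- t)) has_integral Gamma (d + 1)) {0..}"
    using Gamma_integral_real[of "d + 1"] assms by (simp add: exp_minus divide_inverse)
  then show ?thesis by (intro nn_integral_has_integral_lebesgue') auto
qed

text \<open>Write \<open>exp (- \<phi> x)\<close> as the integral of \<open>exp (- t)\<close> over
  \<open>t \<ge> \<phi> x\<close> and exchange the integrals. The inner integral runs over a
  sublevel set of \<open>\<phi>\<close> and scales like \<open>t powr d\<close>, so a Gamma integral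
  remains. Here \<open>d\<close> combines the degree of \<open>f\<close> with the scaling of the
  measure.\<close>

lemma nn_integral_exp_homogeneous:
  fixes N :: "'a measure" and \<phi> :: "'a \<Rightarrow> real" and f :: "'a \<Rightarrow> ennreal"
  assumes "sigma_finite_measure N"
    and [measurable]: "\<phi> \<in> borel_measurable N" "f \<in> borel_measurable N"
    and nonneg: "\<And>x. 0 \<le> \<phi> x" and d: "0 \<le> d"
    and hom: "\<And>t. 0 < t \<Longrightarrow> (\<integral>\<^sup>+x. f x * indicator {x. \<phi> x \<le> t} x \<partial>N) =
       ennreal (t powr d) * (\<integral>\<^sup>+x. f x * indicator {x. \<phi> x \<le> 1} x \<partial>N)"
  shows "(\<integral>\<^sup>+x. f x * ennreal (exp (- \<phi> x)) \<partial>N) =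
    ennreal (Gamma (d + 1)) * (\<integral>\<^sup>+x. f x * indicator {x. \<phi> x \<le> 1} x \<partial>N)"
proof -
  interpret N: sigma_finite_measure N by fact
  interpret pair_sigma_finite N lborel by standard
  let ?c = "\<integral>\<^sup>+x. f x * indicator {x. \<phi> x \<le> 1} x \<partial>N"
  have "(\<integral>\<^sup>+x. f x * ennreal (exp (- \<phi> x)) \<partial>N) =
    (\<integral>\<^sup>+x. \<integral>\<^sup>+t. f x * (ennreal (exp (- t)) * indicator {\<phi> x..} t) \<partial>lborel \<partial>N)"
  proof (intro nn_integral_cong)
    fix x
    show "f x * ennreal (exp (- \<phi> x)) = (\<integral>\<^sup>+t. f x * (ennreal (exp (- t)) * indicator {\<phi> x..} t) \<partial>lborel)"
      by (subst nn_integral_cmult) (simp_all only: nn_integral_exp_tail, measurable)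
  qed
  also have "\<dots> = (\<integral>\<^sup>+t. \<integral>\<^sup>+x. f x * (ennreal (exp (- t)) * indicator {\<phi> x..} t) \<partial>N \<partial>lborel)"
  proof (rule Fubini'[symmetric])
    have "(\<lambda>(x, t). f x * (ennreal (exp (- t)) * (if \<phi> x \<le> t then 1 else 0))) \<in> borel_measurable (N \<Otimes>\<^sub>M lborel)"
      by measurable
    then show "(\<lambda>(x, t). f x * (ennreal (exp (- t)) * indicator {\<phi> x..} t)) \<in> borel_measurable (N \<Otimes>\<^sub>M lborel)"
      by (simp add: indicator_def)
  qed
  also have "\<dots> = (\<integral>\<^sup>+t. ennreal (t powr d * exp (- t)) * indicator {0..} t * ?c \<partial>lborel)"
  \<comment> \<open>The point \<open>t = 0\<close>, not covered by \<open>hom\<close>, is a null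
    set. For negative \<open>t\<close> the sublevel set is empty.\<close>
  proof (rule nn_integral_cong_AE, use AE_lborel_singleton[of "0::real"] in eventually_elim)
    fix t :: real assume t: "t \<noteq> 0"
    have "(\<integral>\<^sup>+x. f x * (ennreal (exp (- t)) * indicator {\<phi> x..} t) \<partial>N) =
      (\<integral>\<^sup>+x. ennreal (exp (- t)) * (f x * indicator {x. \<phi> x \<le> t} x) \<partial>N)"
      by (intro nn_integral_cong) (auto simp: indicator_def mult.commute)
    also have "\<dots> = ennreal (exp (- t)) * (\<integral>\<^sup>+x. f x * indicator {x. \<phi> x \<le> t} x \<partial>N)"
      by (subst nn_integral_cmult) simp_all
    also have "\<dots> = ennreal (t powr d * exp (- t)) * indicator {0..} t * ?c"
    proof (cases "t > 0")
      case True
      then show ?thesis by (simp add: hom[OF True] ennreal_mult mult_ac)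
    next
      case False
      then have "\<not> \<phi> x \<le> t" for x using nonneg[of x] t by auto
      then show ?thesis using False t by (simp add: indicator_def)
    qed
    finally show "(\<integral>\<^sup>+x. f x * (ennreal (exp (- t)) * indicator {\<phi> x..} t) \<partial>N) =
      ennreal (t powr d * exp (- t)) * indicator {0..} t * ?c" .
  qed
  also have "\<dots> = ennreal (Gamma (d + 1)) * ?c"
    by (subst nn_integral_multc) (simp_all add: nn_integral_Gamma d)
  finally show ?thesis .
qed

text \<open>One coordinate at a time: the one-dimensional affine substitution contributes a factor
  \<open>c\<close> in each step. The restricted abstraction keeps the scaled point inside the
  extensional function space.\<close>

lemma nn_integral_PiM_lborel_scale:
  fixes f :: "('i \<Rightarrow> real) \<Rightarrow> ennreal"
  assumes "finite I" "c > 0" "f \<in> borel_measurable (\<Pi>\<^sub>M i\<in>I. lborel)"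
  shows "(\<integral>\<^sup>+x. f x \<partial>(\<Pi>\<^sub>M i\<in>I. lborel)) =
    ennreal (c ^ card I) * (\<integral>\<^sup>+x. f (\<lambda>i\<in>I. c * x i) \<partial>(\<Pi>\<^sub>M i\<in>I. lborel))"
  using assms(1,3)
proof (induction I arbitrary: f rule: finite_induct)
  case empty
  then show ?case by (simp add: PiM_empty nn_integral_count_space_finite)
next
  case (insert i I)
  interpret P: product_sigma_finite "\<lambda>i::'i. lborel :: real measure" by standard
  note insert.prems[measurable]
  have [measurable]: "(\<lambda>x. \<lambda>j\<in>insert i I. c * x j) \<in> (\<Pi>\<^sub>M i\<in>insert i I. lborel) \<rightarrow>\<^sub>M (\<Pi>\<^sub>M i\<in>insert i I. lborel)"
    by (intro measurable_restrict) simp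
  have inner [measurable]: "(\<lambda>x. \<integral>\<^sup>+y. g (x(i := y)) \<partial>lborel) \<in> borel_measurable (\<Pi>\<^sub>M i\<in>I. lborel)"
    if g: "g \<in> borel_measurable (\<Pi>\<^sub>M i\<in>insert i I. lborel)" for g :: "('i \<Rightarrow> real) \<Rightarrow> ennreal"
  proof (rule lborel.borel_measurable_nn_integral)
    show "(\<lambda>(x, y). g (x(i := y))) \<in> borel_measurable ((\<Pi>\<^sub>M i\<in>I. lborel) \<Otimes>\<^sub>M lborel)"
      using measurable_compose[OF measurable_add_dim g] by (simp add: case_prod_beta)
  qed
  have "(\<integral>\<^sup>+x. f x \<partial>(\<Pi>\<^sub>M i\<in>insert i I. lborel)) =
    (\<integral>\<^sup>+x. \<integral>\<^sup>+y. f (x(i := y)) \<partial>lborel \<partial>(\<Pi>\<^sub>M i\<in>I. lborel))"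
    using insert by (intro P.product_nn_integral_insert) auto
  \<comment> \<open>The induction hypothesis is applied to the function obtained by integrating out
    coordinate \<open>i\<close>; that coordinate is rescaled afterwards.\<close>
  also have "\<dots> = ennreal (c ^ card I) *
    (\<integral>\<^sup>+x. \<integral>\<^sup>+y. f ((\<lambda>i\<in>I. c * x i)(i := y)) \<partial>lborel \<partial>(\<Pi>\<^sub>M i\<in>I. lborel))"
    by (intro insert.IH inner insert.prems)
  also have "\<dots> = ennreal (c ^ card I) *
    (\<integral>\<^sup>+x. ennreal c * (\<integral>\<^sup>+y. f (\<lambda>j\<in>insert i I. c * (x(i := y)) j) \<partial>lborel) \<partial>(\<Pi>\<^sub>M i\<in>I. lborel))"
  proof (intro arg_cong2[where f="(*)"] refl nn_integral_cong)
    fix x assume x: "x \<in> space (\<Pi>\<^sub>M i\<in>I. lborel :: real measure)"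
    have [measurable]: "(\<lambda>j\<in>I. c * x j) \<in> space (\<Pi>\<^sub>M i\<in>I. lborel :: real measure)"
      by (simp add: space_PiM)
    have "(\<integral>\<^sup>+y. f ((\<lambda>i\<in>I. c * x i)(i := y)) \<partial>lborel) =
      ennreal \<bar>c\<bar> * (\<integral>\<^sup>+y. f ((\<lambda>i\<in>I. c * x i)(i := 0 + c * y)) \<partial>lborel)"
      using \<open>c > 0\<close> by (intro nn_integral_real_affine) simp_all
    also have "\<dots> = ennreal c * (\<integral>\<^sup>+y. f (\<lambda>j\<in>insert i I. c * (x(i := y)) j) \<partial>lborel)"
    proof -
      have "(\<lambda>i\<in>I. c * x i)(i := 0 + c * y) = (\<lambda>j\<in>insert i I. c * (x(i := y)) j)" for y
        using insert by (auto simp: fun_eq_iff restrict_def)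
      then show ?thesis using \<open>c > 0\<close> by simp
    qed
    finally show "(\<integral>\<^sup>+y. f ((\<lambda>i\<in>I. c * x i)(i := y)) \<partial>lborel) =
      ennreal c * (\<integral>\<^sup>+y. f (\<lambda>j\<in>insert i I. c * (x(i := y)) j) \<partial>lborel)" .
  qed
  also have "\<dots> = ennreal (c ^ card (insert i I)) *
    (\<integral>\<^sup>+x. \<integral>\<^sup>+y. f (\<lambda>j\<in>insert i I. c * (x(i := y)) j) \<partial>lborel \<partial>(\<Pi>\<^sub>M i\<in>I. lborel))"
    using insert \<open>c > 0\<close> inner[of "\<lambda>x. f (\<lambda>j\<in>insert i I. c * x j)"]
    by (subst nn_integral_cmult) (simp_all add: ennreal_mult mult_ac)
  also have "(\<integral>\<^sup>+x. \<integral>\<^sup>+y. f (\<lambda>j\<in>insert i I. c * (x(i := y)) j) \<partial>lborel \<partial>(\<Pi>\<^sub>M i\<in>I. lborel)) =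
    (\<integral>\<^sup>+x. f (\<lambda>j\<in>insert i I. c * x j) \<partial>(\<Pi>\<^sub>M i\<in>insert i I. lborel))"
    using insert by (intro P.product_nn_integral_insert[symmetric]) auto
  finally show ?case .
qed

section \<open>The ball, and exponential integrals in dimension n and in dimension one\<close>

lemma sets_lebesgue_n [measurable_cong]: "sets (lebesgue_n n) = sets (\<Pi>\<^sub>M i\<in>{..<n}. borel)"
  unfolding lebesgue_n_def by (intro sets_PiM_cong) auto

lemma sigma_finite_lebesgue_n: "sigma_finite_measure (lebesgue_n n)"
proof -
  interpret finite_product_sigma_finite "\<lambda>_. lborel :: real measure" "{..<n}" by standard simp
  show ?thesis unfolding lebesgue_n_def by unfold_locales
qed

lemma space_lebesgue_n: "space (lebesgue_n n) = {..<n} \<rightarrow>\<^sub>E UNIV"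
  by (simp add: lebesgue_n_def space_PiM)

lemma sets_lp_ball [measurable]: "lp_ball p n \<in> sets (lebesgue_n n)"
proof -
  have "lp_ball p n = {x \<in> space (lebesgue_n n). (\<Sum>i<n. \<bar>x i\<bar> powr p) \<le> 1}"
    by (auto simp: lp_ball_def space_lebesgue_n)
  also have "\<dots> \<in> sets (lebesgue_n n)" by measurable
  finally show ?thesis .
qed

text \<open>Homogeneity with respect to
  \<open>\<phi> x = (\<Sum>i<n. \<bar>x i\<bar> powr p)\<close>: the volume contributes
  \<open>n / p\<close> to the degree and the linear form contributes
  \<open>2 * k / p\<close>.\<close>

lemma nn_integral_lp_ball_exp:
  fixes p :: real assumes p: "p > 0"
  shows "(\<integral>\<^sup>+x. ennreal ((\<Sum>i<n. a i * x i) ^ (2 * k)) * ennreal (exp (- (\<Sum>i<n. \<bar>x i\<bar> powr p))) \<partial>lebesgue_n n) =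
    ennreal (Gamma ((real n + 2 * real k) / p + 1)) *
    (\<integral>\<^sup>+x. ennreal ((\<Sum>i<n. a i * x i) ^ (2 * k)) * indicator (lp_ball p n) x \<partial>lebesgue_n n)"
proof -
  define \<phi> where "\<phi> x = (\<Sum>i<n. \<bar>x i\<bar> powr p)" for x :: "nat \<Rightarrow> real"
  define f where "f x = ennreal ((\<Sum>i<n. a i * x i) ^ (2 * k))" for x
  have [measurable]: "\<phi> \<in> borel_measurable (lebesgue_n n)" "f \<in> borel_measurable (lebesgue_n n)"
    unfolding \<phi>_def[abs_def] f_def[abs_def] by measurable
  have "(\<integral>\<^sup>+x. f x * ennreal (exp (- \<phi> x)) \<partial>lebesgue_n n) =
    ennreal (Gamma ((real n + 2 * real k) / p + 1)) * (\<integral>\<^sup>+x. f x * indicator {x. \<phi> x \<le> 1} x \<partial>lebesgue_n n)"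
  proof (rule nn_integral_exp_homogeneous[OF sigma_finite_lebesgue_n])
    fix t :: real assume t: "0 < t"
    \<comment> \<open>With this dilation factor, \<open>\<phi>\<close> of the scaled point is
      \<open>t * \<phi> x\<close>, so the sublevel set of \<open>t\<close> becomes the one of
      \<open>1\<close>.\<close>
    define c where "c = t powr (1 / p)"
    have c: "c > 0" "c powr p = t" using t p by (simp_all add: c_def powr_powr)
    have "(\<integral>\<^sup>+x. f x * indicator {x. \<phi> x \<le> t} x \<partial>lebesgue_n n) = ennreal (c ^ n) *
      (\<integral>\<^sup>+x. f (\<lambda>i\<in>{..<n}. c * x i) * indicator {x. \<phi> x \<le> t} (\<lambda>i\<in>{..<n}. c * x i) \<partial>lebesgue_n n)"
      using nn_integral_PiM_lborel_scale[of "{..<n}" c "\<lambda>x. f x * indicator {x. \<phi> x \<le> t} x"] c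
      by (simp add: lebesgue_n_def[symmetric])
    also have "\<dots> = ennreal (c ^ n) *
      (\<integral>\<^sup>+x. ennreal (c ^ (2 * k)) * (f x * indicator {x. \<phi> x \<le> 1} x) \<partial>lebesgue_n n)"
    proof (rule arg_cong2[where f="(*)", OF refl nn_integral_cong])
      fix x :: "nat \<Rightarrow> real"
      have "\<phi> (\<lambda>i\<in>{..<n}. c * x i) = t * \<phi> x"
        using c t by (simp add: \<phi>_def abs_mult powr_mult sum_distrib_left)
      moreover have "(\<Sum>i<n. a i * (c * x i)) = c * (\<Sum>i<n. a i * x i)"
        by (simp add: sum_distrib_left mult_ac)
      ultimately show "f (\<lambda>i\<in>{..<n}. c * x i) * indicator {x. \<phi> x \<le> t} (\<lambda>i\<in>{..<n}. c * x i) =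
        ennreal (c ^ (2 * k)) * (f x * indicator {x. \<phi> x \<le> 1} x)"
        using t c by (simp add: f_def power_mult_distrib ennreal_mult indicator_def)
    qed
    also have "\<dots> = ennreal (c ^ n) * ennreal (c ^ (2 * k)) * (\<integral>\<^sup>+x. f x * indicator {x. \<phi> x \<le> 1} x \<partial>lebesgue_n n)"
      by (subst nn_integral_cmult) (simp_all add: mult.assoc)
    also have "ennreal (c ^ n) * ennreal (c ^ (2 * k)) = ennreal (t powr ((real n + 2 * real k) / p))"
    proof -
      have "c ^ n * c ^ (2 * k) = c powr real (n + 2 * k)"
        using c(1) by (subst powr_realpow) (simp_all add: power_add)
      also have "\<dots> = t powr ((real n + 2 * real k) / p)"
        by (simp add: c_def powr_powr)
      finally show ?thesis using c(1) by (simp add: ennreal_mult[symmetric])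
    qed
    finally show "(\<integral>\<^sup>+x. f x * indicator {x. \<phi> x \<le> t} x \<partial>lebesgue_n n) =
      ennreal (t powr ((real n + 2 * real k) / p)) *
      (\<integral>\<^sup>+x. f x * indicator {x. \<phi> x \<le> 1} x \<partial>lebesgue_n n)" .
  qed (use p in \<open>auto simp: \<phi>_def intro!: sum_nonneg\<close>)
  also have "(\<integral>\<^sup>+x. f x * indicator {x. \<phi> x \<le> 1} x \<partial>lebesgue_n n) =
    (\<integral>\<^sup>+x. f x * indicator (lp_ball p n) x \<partial>lebesgue_n n)"
    by (intro nn_integral_cong) (auto simp: indicator_def lp_ball_def \<phi>_def space_lebesgue_n)
  finally show ?thesis by (simp add: f_def \<phi>_def)
qed

text \<open>The same homogeneity argument on the line, where the sublevel set is
  \<open>{-1..1}\<close> and the power integrates to \<open>2 / (2 * real j + 1)\<close>. The case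
  \<open>j = 0\<close> gives the normalising constant of the density.\<close>

lemma nn_integral_power_exp_powr:
  fixes p :: real assumes p: "p > 0"
  shows "(\<integral>\<^sup>+t. ennreal (t ^ (2 * j)) * ennreal (exp (- (\<bar>t\<bar> powr p))) \<partial>lborel) =
    ennreal (Gamma ((2 * real j + 1) / p + 1) * (2 / (2 * real j + 1)))"
proof -
  have "(\<integral>\<^sup>+t. ennreal (t ^ (2 * j)) * ennreal (exp (- (\<bar>t\<bar> powr p))) \<partial>lborel) =
    ennreal (Gamma ((2 * real j + 1) / p + 1)) *
    (\<integral>\<^sup>+t. ennreal (t ^ (2 * j)) * indicator {t. \<bar>t\<bar> powr p \<le> 1} t \<partial>lborel)"
  proof (rule nn_integral_exp_homogeneous)
    fix s :: real assume s: "0 < s"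
    define c where "c = s powr (1 / p)"
    have c: "c > 0" "c powr p = s" using s p by (simp_all add: c_def powr_powr)
    have "(\<integral>\<^sup>+t. ennreal (t ^ (2 * j)) * indicator {t. \<bar>t\<bar> powr p \<le> s} t \<partial>lborel) =
      ennreal \<bar>c\<bar> * (\<integral>\<^sup>+t. ennreal ((0 + c * t) ^ (2 * j)) * indicator {t. \<bar>t\<bar> powr p \<le> s} (0 + c * t) \<partial>lborel)"
      using c by (intro nn_integral_real_affine) simp_all
    also have "\<dots> = ennreal c *
      (\<integral>\<^sup>+t. ennreal (c ^ (2 * j)) * (ennreal (t ^ (2 * j)) * indicator {t. \<bar>t\<bar> powr p \<le> 1} t) \<partial>lborel)"
    proof (rule arg_cong2[where f="(*)", OF _ nn_integral_cong])
      fix t :: real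
      have "\<bar>0 + c * t\<bar> powr p = s * \<bar>t\<bar> powr p"
        using c by (simp add: abs_mult powr_mult)
      then have "indicator {t. \<bar>t\<bar> powr p \<le> s} (0 + c * t) = (indicator {t. \<bar>t\<bar> powr p \<le> 1} t :: ennreal)"
        using s by (simp add: indicator_def)
      moreover have "ennreal ((0 + c * t) ^ (2 * j)) = ennreal (c ^ (2 * j)) * ennreal (t ^ (2 * j))"
        by (simp add: power_mult_distrib ennreal_mult)
      ultimately show "ennreal ((0 + c * t) ^ (2 * j)) * indicator {t. \<bar>t\<bar> powr p \<le> s} (0 + c * t) =
        ennreal (c ^ (2 * j)) * (ennreal (t ^ (2 * j)) * indicator {t. \<bar>t\<bar> powr p \<le> 1} t)"
        by (simp only: mult.assoc)
    qed (use c in simp)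
    also have "\<dots> = ennreal c * ennreal (c ^ (2 * j)) *
      (\<integral>\<^sup>+t. ennreal (t ^ (2 * j)) * indicator {t. \<bar>t\<bar> powr p \<le> 1} t \<partial>lborel)"
      by (subst nn_integral_cmult) (simp_all add: mult.assoc)
    also have "ennreal c * ennreal (c ^ (2 * j)) = ennreal (s powr ((2 * real j + 1) / p))"
    proof -
      have "c * c ^ (2 * j) = c powr real (2 * j + 1)"
        using c(1) by (subst powr_realpow) simp_all
      also have "\<dots> = s powr ((2 * real j + 1) / p)"
        by (simp add: c_def powr_powr add.commute)
      finally show ?thesis using c(1) by (simp add: ennreal_mult[symmetric])
    qed
    finally show "(\<integral>\<^sup>+t. ennreal (t ^ (2 * j)) * indicator {t. \<bar>t\<bar> powr p \<le> s} t \<partial>lborel) =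
      ennreal (s powr ((2 * real j + 1) / p)) *
      (\<integral>\<^sup>+t. ennreal (t ^ (2 * j)) * indicator {t. \<bar>t\<bar> powr p \<le> 1} t \<partial>lborel)" .
  qed (use p in \<open>auto intro: lborel.sigma_finite_measure_axioms\<close>)
  also have "(\<integral>\<^sup>+t. ennreal (t ^ (2 * j)) * indicator {t. \<bar>t\<bar> powr p \<le> 1} t \<partial>lborel) =
    (\<integral>\<^sup>+t. ennreal (t ^ (2 * j)) * indicator {-1..1::real} t \<partial>lborel)"
  proof -
    have "\<bar>t\<bar> powr p \<le> 1 \<longleftrightarrow> \<bar>t\<bar> \<le> 1" for t :: real
    proof (cases "\<bar>t\<bar> \<le> 1")
      case True
      then show ?thesis using p powr_mono2[of p "\<bar>t\<bar>" 1] by auto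
    next
      case False
      then have "1 powr p < \<bar>t\<bar> powr p" using p by (intro powr_less_mono2) auto
      then show ?thesis using False by simp
    qed
    then have "\<bar>t\<bar> powr p \<le> 1 \<longleftrightarrow> t \<in> {-1..1}" for t :: real by (auto simp: abs_le_iff)
    then show ?thesis by (intro nn_integral_cong) (auto simp: indicator_def)
  qed
  also have "\<dots> = ennreal (1 ^ Suc (2 * j) / real (Suc (2 * j)) - (-1) ^ Suc (2 * j) / real (Suc (2 * j)))"
  proof (rule nn_integral_FTC_Icc)
    fix t :: real
    have "((\<lambda>t. t ^ Suc (2 * j) / real (Suc (2 * j))) has_real_derivative
        (real (Suc (2 * j)) * t ^ (Suc (2 * j) - Suc 0)) / real (Suc (2 * j))) (at t)"
      by (intro DERIV_cdivide DERIV_pow)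
    then show "((\<lambda>t. t ^ Suc (2 * j) / real (Suc (2 * j))) has_real_derivative t ^ (2 * j)) (at t)"
      by (simp del: of_nat_Suc power_Suc)
  qed simp_all
  also have "\<dots> = ennreal (2 / (2 * real j + 1))" by (simp add: add.commute)
  finally have "(\<integral>\<^sup>+t. ennreal (t ^ (2 * j)) * ennreal (exp (- (\<bar>t\<bar> powr p))) \<partial>lborel) =
    ennreal (Gamma ((2 * real j + 1) / p + 1)) * ennreal (2 / (2 * real j + 1))" .
  moreover have "Gamma ((2 * real j + 1) / p + 1) > 0"
    using p by (intro Gamma_real_pos add_nonneg_pos) auto
  ultimately show ?thesis by (simp add: ennreal_mult[symmetric])
qed

section \<open>The law with density proportional to \<open>exp (- (\<bar>t\<bar> powr p))\<close>
  and its products\<close>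

text \<open>A product measure is determined by its values on boxes. There the indicator is itself a
  product, so the integral of the density factors.\<close>

lemma (in product_sigma_finite) PiM_density:
  assumes "finite I" and [measurable]: "\<And>i. i \<in> I \<Longrightarrow> f i \<in> borel_measurable (M i)"
    and "product_sigma_finite (\<lambda>i. density (M i) (f i))"
  shows "density (Pi\<^sub>M I M) (\<lambda>x. \<Prod>i\<in>I. f i (x i)) = (\<Pi>\<^sub>M i\<in>I. density (M i) (f i))"
proof -
  interpret D: product_sigma_finite "\<lambda>i. density (M i) (f i)" by fact
  have [measurable]: "(\<lambda>x. \<Prod>i\<in>I. f i (x i)) \<in> borel_measurable (Pi\<^sub>M I M)"
    by measurable
  show ?thesis
  proof (rule D.PiM_eqI[OF assms(1)])
    show "sets (density (Pi\<^sub>M I M) (\<lambda>x. \<Prod>i\<in>I. f i (x i))) = sets (\<Pi>\<^sub>M i\<in>I. density (M i) (f i))"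
      unfolding sets_density by (intro sets_PiM_cong) auto
  next
    fix A assume "\<And>i. i \<in> I \<Longrightarrow> A i \<in> sets (density (M i) (f i))"
    then have A [measurable]: "\<And>i. i \<in> I \<Longrightarrow> A i \<in> sets (M i)" by simp
    have [measurable]: "Pi\<^sub>E I A \<in> sets (Pi\<^sub>M I M)" using assms A by (intro sets_PiM_I_finite)
    have "emeasure (density (Pi\<^sub>M I M) (\<lambda>x. \<Prod>i\<in>I. f i (x i))) (Pi\<^sub>E I A) =
      (\<integral>\<^sup>+x. (\<Prod>i\<in>I. f i (x i)) * indicator (Pi\<^sub>E I A) x \<partial>Pi\<^sub>M I M)"
      by (subst emeasure_density) simp_all
    also have "\<dots> = (\<integral>\<^sup>+x. (\<Prod>i\<in>I. f i (x i) * indicator (A i) (x i)) \<partial>Pi\<^sub>M I M)"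
    proof (intro nn_integral_cong)
      fix x assume x: "x \<in> space (Pi\<^sub>M I M)"
      show "(\<Prod>i\<in>I. f i (x i)) * indicator (Pi\<^sub>E I A) x = (\<Prod>i\<in>I. f i (x i) * indicator (A i) (x i))"
      proof (cases "x \<in> Pi\<^sub>E I A")
        case True
        then have "i \<in> I \<Longrightarrow> x i \<in> A i" for i by auto
        then show ?thesis using True by (simp cong: prod.cong)
      next
        case False
        then obtain i where i: "i \<in> I" "x i \<notin> A i"
          using x by (auto simp: space_PiM PiE_def)
        then have "(\<Prod>i\<in>I. f i (x i) * indicator (A i) (x i)) = 0"
          using assms(1) by (intro prod_zero bexI[of _ i]) auto
        then show ?thesis using False by simp
      qed
    qed
    also have "\<dots> = (\<Prod>i\<in>I. \<integral>\<^sup>+x. f i x * indicator (A i) x \<partial>M i)"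
      using assms(1) by (intro product_nn_integral_prod) measurable
    also have "\<dots> = (\<Prod>i\<in>I. emeasure (density (M i) (f i)) (A i))"
      by (intro prod.cong refl) (simp add: emeasure_density)
    finally show "emeasure (density (Pi\<^sub>M I M) (\<lambda>x. \<Prod>i\<in>I. f i (x i))) (Pi\<^sub>E I A) =
      (\<Prod>i\<in>I. emeasure (density (M i) (f i)) (A i))" .
  qed
qed

definition gen_normal :: "real \<Rightarrow> real measure" where
  "gen_normal p = density lborel (\<lambda>t. ennreal (exp (- (\<bar>t\<bar> powr p)) / (2 * Gamma (1 / p + 1))))"

text \<open>Closed form of the moment of order \<open>2 * j\<close> of
  \<open>gen_normal p\<close>.\<close>

definition gen_normal_moment :: "real \<Rightarrow> nat \<Rightarrow> real" where
  "gen_normal_moment p j =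
     Gamma ((2 * real j + 1) / p + 1) / ((2 * real j + 1) * Gamma (1 / p + 1))"

lemma sets_gen_normal [measurable_cong, simp]: "sets (gen_normal p) = sets borel"
  by (simp add: gen_normal_def)

lemma Gamma_plus1_pos: "0 \<le> x \<Longrightarrow> 0 < Gamma (x + 1 :: real)"
  by (rule Gamma_real_pos) simp

lemma nn_integral_gen_normal:
  assumes p: "p > 0"
  shows "(\<integral>\<^sup>+t. ennreal (t ^ (2 * j)) \<partial>gen_normal p) = ennreal (gen_normal_moment p j)"
proof -
  let ?Z = "2 * Gamma (1 / p + 1)"
  have Z: "?Z > 0" using p by (simp add: Gamma_plus1_pos)
  have "(\<integral>\<^sup>+t. ennreal (t ^ (2 * j)) \<partial>gen_normal p) =
    (\<integral>\<^sup>+t. ennreal (1 / ?Z) * (ennreal (t ^ (2 * j)) * ennreal (exp (- (\<bar>t\<bar> powr p)))) \<partial>lborel)"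
  proof -
    have "ennreal (e / ?Z) * ennreal u = ennreal (1 / ?Z) * (ennreal u * ennreal e)" if "0 \<le> e" "0 \<le> u" for e u
      using that Z by (simp add: ennreal_mult[symmetric] mult.commute)
    then show ?thesis
      unfolding gen_normal_def by (subst nn_integral_density) (auto intro!: nn_integral_cong)
  qed
  also have "\<dots> = ennreal (1 / ?Z) * ennreal (Gamma ((2 * real j + 1) / p + 1) * (2 / (2 * real j + 1)))"
    by (subst nn_integral_cmult) (simp_all add: nn_integral_power_exp_powr p)
  also have "\<dots> = ennreal (gen_normal_moment p j)"
    using Z p by (simp add: ennreal_mult[symmetric] gen_normal_moment_def Gamma_plus1_pos less_imp_le)
  finally show ?thesis .
qed

lemma gen_normal_moment_0 [simp]: "p > 0 \<Longrightarrow> gen_normal_moment p 0 = 1"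
  using Gamma_plus1_pos[of "1 / p"] by (simp add: gen_normal_moment_def)

lemma gen_normal_moment_nonneg: "p > 0 \<Longrightarrow> 0 \<le> gen_normal_moment p j"
  by (simp add: gen_normal_moment_def Gamma_plus1_pos less_imp_le)

lemma prob_space_gen_normal:
  assumes "p > 0" shows "prob_space (gen_normal p)"
  using nn_integral_gen_normal[OF assms, of 0] assms by (intro prob_spaceI) simp

text \<open>Integrability of odd powers follows from
  \<open>\<bar>t\<bar> ^ k \<le> 1 + t ^ (2 * k)\<close>, a consequence of expanding a square. Odd
  moments vanish by the substitution of \<open>- t\<close> for \<open>t\<close>.\<close>

lemma gen_normal_power:
  assumes p: "p > 0"
  shows "integrable (gen_normal p) (\<lambda>t. t ^ k)"
    and "(LINT t|gen_normal p. t ^ (2 * j)) = gen_normal_moment p j"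
    and "odd k \<Longrightarrow> (LINT t|gen_normal p. t ^ k) = 0"
proof -
  interpret prob_space "gen_normal p" using p by (rule prob_space_gen_normal)
  have even: "integrable (gen_normal p) (\<lambda>t. t ^ (2 * j))" for j
    by (rule integrableI_nonneg) (simp_all add: nn_integral_gen_normal p)
  show "integrable (gen_normal p) (\<lambda>t. t ^ k)" for k
  proof (rule Bochner_Integration.integrable_bound)
    show "integrable (gen_normal p) (\<lambda>t. 1 + t ^ (2 * k))" by (simp add: even)
    have "\<bar>t\<bar> ^ k \<le> 1 + t ^ (2 * k)" for t :: real
    proof -
      have "0 \<le> (\<bar>t\<bar> ^ k - 1)\<^sup>2" by simp
      moreover have "(\<bar>t\<bar> ^ k)\<^sup>2 = t ^ (2 * k)" by (simp add: power_even_abs mult.commute flip: power_mult)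
      ultimately have "2 * \<bar>t\<bar> ^ k \<le> 1 + t ^ (2 * k)" by (simp add: power2_diff)
      then show ?thesis using zero_le_power[OF abs_ge_zero, of t k] by linarith
    qed
    then show "AE t in gen_normal p. norm (t ^ k) \<le> norm (1 + t ^ (2 * k))"
      by (simp add: power_abs)
  qed simp
  show "(LINT t|gen_normal p. t ^ (2 * j)) = gen_normal_moment p j"
    using nn_integral_gen_normal[OF p, of j] p
    by (simp add: integral_eq_nn_integral gen_normal_moment_nonneg)
  assume "odd k"
  let ?g = "\<lambda>t. exp (- (\<bar>t\<bar> powr p)) / (2 * Gamma (1 / p + 1))"
  have eq: "(LINT t|gen_normal p. t ^ k) = (LINT t|lborel. ?g t * t ^ k)"
    unfolding gen_normal_def using p
    by (subst integral_density) (simp_all add: Gamma_plus1_pos less_imp_le)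
  also have "\<dots> = \<bar>- 1\<bar> *\<^sub>R (LINT t|lborel. ?g (0 + (- 1) * t) * (0 + (- 1) * t) ^ k)"
    by (rule lborel_integral_real_affine) simp
  also have "\<dots> = - (LINT t|gen_normal p. t ^ k)"
    unfolding eq using \<open>odd k\<close> by (simp add: power_minus_odd)
  finally show "(LINT t|gen_normal p. t ^ k) = 0" by simp
qed

definition gen_normal_n :: "real \<Rightarrow> nat \<Rightarrow> (nat \<Rightarrow> real) measure" where
  "gen_normal_n p n = (\<Pi>\<^sub>M i\<in>{..<n}. gen_normal p)"

lemma sets_gen_normal_n [measurable_cong]: "sets (gen_normal_n p n) = sets (\<Pi>\<^sub>M i\<in>{..<n}. borel)"
  unfolding gen_normal_n_def by (intro sets_PiM_cong) auto

lemma prob_space_gen_normal_n: "p > 0 \<Longrightarrow> prob_space (gen_normal_n p n)"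
  unfolding gen_normal_n_def by (intro prob_space_PiM prob_space_gen_normal)

lemma gen_normal_n_component:
  assumes "p > 0" "i < n"
  shows "distr (gen_normal_n p n) borel (\<lambda>x. x i) = gen_normal p"
proof -
  have "distr (gen_normal_n p n) (gen_normal p) (\<lambda>x. x i) = gen_normal p"
    unfolding gen_normal_n_def using assms by (intro distr_PiM_component prob_space_gen_normal) auto
  moreover have "distr (gen_normal_n p n) (gen_normal p) (\<lambda>x. x i) = distr (gen_normal_n p n) borel (\<lambda>x. x i)"
    by (intro distr_cong) auto
  ultimately show ?thesis by simp
qed

lemma integral_gen_normal_n_component:
  fixes f :: "real \<Rightarrow> real"
  assumes "p > 0" "i < n" and [measurable]: "f \<in> borel_measurable borel"
  shows "integrable (gen_normal_n p n) (\<lambda>x. f (x i)) \<longleftrightarrow> integrable (gen_normal p) f"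
    and "(LINT x|gen_normal_n p n. f (x i)) = (LINT t|gen_normal p. f t)"
proof -
  have [measurable]: "i \<in> {..<n}" using assms by simp
  have [measurable]: "(\<lambda>x. x i) \<in> borel_measurable (gen_normal_n p n)" by measurable
  show "integrable (gen_normal_n p n) (\<lambda>x. f (x i)) \<longleftrightarrow> integrable (gen_normal p) f"
    unfolding gen_normal_n_component[OF assms(1,2), symmetric]
    by (subst integrable_distr_eq) simp_all
  show "(LINT x|gen_normal_n p n. f (x i)) = (LINT t|gen_normal p. f t)"
    unfolding gen_normal_n_component[OF assms(1,2), symmetric]
    by (subst integral_distr) simp_all
qed

lemma indep_symmetric_gen_normal_n:
  assumes p: "p > 0" and n: "n > 0"
  shows "indep_symmetric (gen_normal_n p n) (\<lambda>i x. a i * x i) {..<n}"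
proof -
  interpret prob_space "gen_normal_n p n" using p by (rule prob_space_gen_normal_n)
  have "indep_vars (\<lambda>_. borel) (\<lambda>i x. x i) {..<n}"
  proof (subst indep_vars_iff_distr_eq_PiM')
    \<comment> \<open>Restriction to \<open>{..<n}\<close> is the identity on this space, so the
      joint law of the coordinates is the product measure itself, hence the product of its
      marginals.\<close>
    have "distr (gen_normal_n p n) (\<Pi>\<^sub>M i\<in>{..<n}. borel) (\<lambda>x. \<lambda>i\<in>{..<n}. x i) =
      distr (gen_normal_n p n) (gen_normal_n p n) (\<lambda>x. x)"
    proof (rule distr_cong[OF refl])
      show "sets (\<Pi>\<^sub>M i\<in>{..<n}. borel) = sets (gen_normal_n p n)" by (simp only: sets_gen_normal_n)
    qed (auto simp: gen_normal_n_def space_PiM PiE_def extensional_restrict)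
    also have "\<dots> = gen_normal_n p n" by (rule distr_id)
    also have "\<dots> = (\<Pi>\<^sub>M i\<in>{..<n}. distr (gen_normal_n p n) borel (\<lambda>x. x i))"
      unfolding gen_normal_n_def[of p n]
      by (intro PiM_cong refl gen_normal_n_component[OF p, unfolded gen_normal_n_def, symmetric]) simp
    finally show "distr (gen_normal_n p n) (\<Pi>\<^sub>M i\<in>{..<n}. borel) (\<lambda>x. \<lambda>i\<in>{..<n}. x i) =
      (\<Pi>\<^sub>M i\<in>{..<n}. distr (gen_normal_n p n) borel (\<lambda>x. x i))" .
  qed (use n in auto)
  then have iv: "indep_vars (\<lambda>_. borel) (\<lambda>i x. a i * x i) {..<n}"
    by (rule indep_vars_compose2[where Y="\<lambda>i t. a i * t"]) simp
  show ?thesis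
  proof (unfold_locales, rule iv)
    fix i k assume "i \<in> {..<n}"
    then have i: "i < n" by simp
    show "integrable (gen_normal_n p n) (\<lambda>x. (a i * x i) ^ k)"
      using integral_gen_normal_n_component(1)[OF p i, of "\<lambda>t. (a i * t) ^ k"] gen_normal_power(1)[OF p]
      by (simp add: power_mult_distrib)
    assume "odd k"
    then show "expectation (\<lambda>x. (a i * x i) ^ k) = 0"
      using integral_gen_normal_n_component(2)[OF p i, of "\<lambda>t. (a i * t) ^ k"] gen_normal_power(3)[OF p]
      by (simp add: power_mult_distrib)
  qed
qed

lemma nn_integral_gen_normal_n:
  assumes p: "p > 0" and [measurable]: "f \<in> borel_measurable (\<Pi>\<^sub>M i\<in>{..<n}. borel)"
  shows "(\<integral>\<^sup>+x. f x \<partial>gen_normal_n p n) = ennreal ((1 / (2 * Gamma (1 / p + 1))) ^ n) *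
    (\<integral>\<^sup>+x. f x * ennreal (exp (- (\<Sum>i<n. \<bar>x i\<bar> powr p))) \<partial>lebesgue_n n)"
proof -
  interpret product_sigma_finite "\<lambda>_::nat. lborel :: real measure" by standard
  let ?Z = "2 * Gamma (1 / p + 1)"
  let ?g = "\<lambda>t. ennreal (exp (- (\<bar>t\<bar> powr p)) / ?Z)"
  have Z: "?Z > 0" using p by (simp add: Gamma_plus1_pos)
  interpret prob_space "gen_normal p" using p by (rule prob_space_gen_normal)
  have "product_sigma_finite (\<lambda>_::nat. gen_normal p)" by standard
  then have "gen_normal_n p n = density (lebesgue_n n) (\<lambda>x. \<Prod>i<n. ?g (x i))"
    unfolding gen_normal_n_def gen_normal_def lebesgue_n_def
    by (intro PiM_density[symmetric]) (simp_all add: gen_normal_def)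
  then have "(\<integral>\<^sup>+x. f x \<partial>gen_normal_n p n) = (\<integral>\<^sup>+x. (\<Prod>i<n. ?g (x i)) * f x \<partial>lebesgue_n n)"
    by (simp add: nn_integral_density)
  also have "\<dots> = (\<integral>\<^sup>+x. ennreal ((1 / ?Z) ^ n) * (f x * ennreal (exp (- (\<Sum>i<n. \<bar>x i\<bar> powr p)))) \<partial>lebesgue_n n)"
  proof (intro nn_integral_cong)
    fix x :: "nat \<Rightarrow> real"
    have "(\<Prod>i<n. ?g (x i)) = ennreal (\<Prod>i<n. (1 / ?Z) * exp (- (\<bar>x i\<bar> powr p)))"
      using Z by (subst prod_ennreal) auto
    also have "(\<Prod>i<n. (1 / ?Z) * exp (- (\<bar>x i\<bar> powr p))) = (1 / ?Z) ^ n * exp (- (\<Sum>i<n. \<bar>x i\<bar> powr p))"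
      by (simp only: prod.distrib prod_constant card_lessThan exp_sum[OF finite_lessThan, symmetric] sum_negf)
    also have "ennreal \<dots> = ennreal ((1 / ?Z) ^ n) * ennreal (exp (- (\<Sum>i<n. \<bar>x i\<bar> powr p)))"
      using Z by (intro ennreal_mult) auto
    finally show "(\<Prod>i<n. ?g (x i)) * f x =
      ennreal ((1 / ?Z) ^ n) * (f x * ennreal (exp (- (\<Sum>i<n. \<bar>x i\<bar> powr p))))"
      by (simp only: mult_ac)
  qed
  also have "\<dots> = ennreal ((1 / ?Z) ^ n) *
    (\<integral>\<^sup>+x. f x * ennreal (exp (- (\<Sum>i<n. \<bar>x i\<bar> powr p))) \<partial>lebesgue_n n)"
    by (rule nn_integral_cmult) measurable
  finally show ?thesis .
qed

text \<open>Both sides are tied to the integral of the power against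
  \<open>exp (- (\<Sum>i<n. \<bar>x i\<bar> powr p))\<close>: the product law by its density, the
  ball by homogeneity.\<close>

lemma nn_integral_power_lp_ball:
  assumes p: "p > 0"
  shows "(\<integral>\<^sup>+x. ennreal ((\<Sum>i<n. a i * x i) ^ (2 * k)) * indicator (lp_ball p n) x \<partial>lebesgue_n n) =
    ennreal ((2 * Gamma (1 / p + 1)) ^ n / Gamma ((real n + 2 * real k) / p + 1)) *
    (\<integral>\<^sup>+x. ennreal ((\<Sum>i<n. a i * x i) ^ (2 * k)) \<partial>gen_normal_n p n)" (is "?B = _ * ?G")
proof -
  let ?Z = "2 * Gamma (1 / p + 1)"
  let ?R = "Gamma ((real n + 2 * real k) / p + 1)"
  have Z: "?Z > 0" and R: "?R > 0" using p by (simp_all add: Gamma_plus1_pos)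
  have "?G = ennreal ((1 / ?Z) ^ n) * (ennreal ?R * ?B)"
    by (subst nn_integral_gen_normal_n[OF p]) (simp_all only: nn_integral_lp_ball_exp[OF p], measurable)
  \<comment> \<open>The real coefficients are collected first, so that the cancellation takes place
    in \<open>real\<close> even though the integrals live in \<open>ennreal\<close>.\<close>
  then have "ennreal (?Z ^ n / ?R) * ?G = ennreal (?Z ^ n / ?R * (1 / ?Z) ^ n * ?R) * ?B"
  proof -
    have "ennreal u * (ennreal v * (ennreal w * b)) = ennreal (u * v * w) * b"
      if "0 \<le> u" "0 \<le> v" "0 \<le> w" for u v w b
      using that by (simp add: ennreal_mult mult.assoc)
    moreover have "0 \<le> ?Z ^ n / ?R" "0 \<le> (1 / ?Z) ^ n" "0 \<le> ?R" using Z R by simp_all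
    ultimately show "ennreal (?Z ^ n / ?R) * ?G = ennreal (?Z ^ n / ?R * (1 / ?Z) ^ n * ?R) * ?B"
      if "?G = ennreal ((1 / ?Z) ^ n) * (ennreal ?R * ?B)"
      unfolding that by blast
  qed
  also have "?Z ^ n / ?R * (1 / ?Z) ^ n * ?R = 1"
    using Z R by (simp add: power_one_over field_simps)
  finally show ?thesis by simp
qed

lemma measure_lp_ball:
  assumes p: "p > 0"
  shows "measure (lebesgue_n n) (lp_ball p n) = (2 * Gamma (1 / p + 1)) ^ n / Gamma (real n / p + 1)"
    and "emeasure (lebesgue_n n) (lp_ball p n) = ennreal (measure (lebesgue_n n) (lp_ball p n))"
    and "0 < measure (lebesgue_n n) (lp_ball p n)"
proof -
  let ?v = "(2 * Gamma (1 / p + 1)) ^ n / Gamma (real n / p + 1)"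
  interpret prob_space "gen_normal_n p n" using p by (rule prob_space_gen_normal_n)
  \<comment> \<open>The zero form with \<open>k = 0\<close> has integrand \<open>0 ^ 0 = 1\<close>,
    which turns the moment formula into the volume.\<close>
  have "emeasure (lebesgue_n n) (lp_ball p n) = ennreal ?v"
    using nn_integral_power_lp_ball[OF p, of n "\<lambda>_. 0" 0] by (simp add: emeasure_space_1)
  moreover have "?v > 0" using p by (intro divide_pos_pos zero_less_power) (simp_all add: Gamma_plus1_pos)
  moreover from calculation show "measure (lebesgue_n n) (lp_ball p n) = ?v"
    by (intro measure_eq_emeasure_eq_ennreal) auto
  ultimately show "emeasure (lebesgue_n n) (lp_ball p n) = ennreal (measure (lebesgue_n n) (lp_ball p n))"
    "0 < measure (lebesgue_n n) (lp_ball p n)" by simp_all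
qed

section \<open>The uniform distribution on the ball\<close>

definition uniform_lp_ball :: "real \<Rightarrow> nat \<Rightarrow> (nat \<Rightarrow> real) measure" where
  "uniform_lp_ball p n = uniform_measure (lebesgue_n n) (lp_ball p n)"

lemma sets_uniform_lp_ball [measurable_cong]: "sets (uniform_lp_ball p n) = sets (\<Pi>\<^sub>M i\<in>{..<n}. borel)"
  by (simp add: uniform_lp_ball_def sets_lebesgue_n)

lemma prob_space_uniform_lp_ball: "p > 0 \<Longrightarrow> prob_space (uniform_lp_ball p n)"
  unfolding uniform_lp_ball_def
  by (rule prob_space_uniform_measure)
    (simp_all add: measure_lp_ball(2) measure_lp_ball(3)[THEN less_imp_neq, symmetric] measure_lp_ball(3))

lemma AE_uniform_lp_ball: "AE x in uniform_lp_ball p n. x \<in> lp_ball p n"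
  unfolding uniform_lp_ball_def by (rule AE_uniform_measureI) simp_all

lemma uniform_lp_ball_density:
  assumes p: "p > 0"
  shows "uniform_lp_ball p n = density (lebesgue_n n)
    (\<lambda>x. ennreal (indicator (lp_ball p n) x / measure (lebesgue_n n) (lp_ball p n)))"
  unfolding uniform_lp_ball_def uniform_measure_def measure_lp_ball(2)[OF p] using measure_lp_ball(3)[OF p, of n]
  by (intro density_cong) (auto simp: indicator_def divide_ennreal simp flip: ennreal_1)

lemma integral_uniform_lp_ball:
  assumes p: "p > 0" and [measurable]: "f \<in> borel_measurable (\<Pi>\<^sub>M i\<in>{..<n}. borel)"
  shows "(LINT x|uniform_lp_ball p n. f x) =
    1 / measure (lebesgue_n n) (lp_ball p n) * (LINT x:lp_ball p n|lebesgue_n n. f x :: real)"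
proof -
  have "(LINT x|uniform_lp_ball p n. f x) =
    (LINT x|lebesgue_n n. 1 / measure (lebesgue_n n) (lp_ball p n) * (indicator (lp_ball p n) x * f x))"
    unfolding uniform_lp_ball_density[OF p]
    by (subst integral_density) (auto intro!: Bochner_Integration.integral_cong)
  then show ?thesis by (simp add: set_lebesgue_integral_def)
qed

lemma Lq_norm_lp_ball_eq:
  assumes p: "p > 0"
  shows "Lq_norm_lp_ball p q n a = (LINT x|uniform_lp_ball p n. \<bar>\<Sum>i<n. a i * x i\<bar> powr q) powr (1 / q)"
  unfolding Lq_norm_lp_ball_def using p by (subst integral_uniform_lp_ball) simp_all

text \<open>The power of \<open>2 * Gamma (1 / p + 1)\<close> occurs both in the integral and in the
  volume and cancels. What remains is a ratio of Gamma values that does not depend on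
  \<open>a\<close>.\<close>

lemma uniform_lp_ball_power:
  assumes p: "p > 0" and n: "n > 0"
  shows "(LINT x|uniform_lp_ball p n. (\<Sum>i<n. a i * x i) ^ (2 * k)) =
    Gamma (real n / p + 1) / Gamma ((real n + 2 * real k) / p + 1) *
    (LINT x|gen_normal_n p n. (\<Sum>i<n. a i * x i) ^ (2 * k))" (is "?B = _ * ?G")
proof -
  interpret indep_symmetric "gen_normal_n p n" "\<lambda>i x. a i * x i" "{..<n}"
    using assms by (rule indep_symmetric_gen_normal_n)
  let ?Z = "2 * Gamma (1 / p + 1)"
  let ?R = "Gamma ((real n + 2 * real k) / p + 1)"
  have pos: "?Z > 0" "?R > 0" "Gamma (real n / p + 1) > 0" using p by (simp_all add: Gamma_plus1_pos)
  have G: "(\<integral>\<^sup>+x. ennreal ((\<Sum>i<n. a i * x i) ^ (2 * k)) \<partial>gen_normal_n p n) = ennreal ?G"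
    by (intro nn_integral_eq_integral integrable_sum_pow) auto
  have "(LINT x:lp_ball p n|lebesgue_n n. (\<Sum>i<n. a i * x i) ^ (2 * k)) =
    enn2real (\<integral>\<^sup>+x. ennreal ((\<Sum>i<n. a i * x i) ^ (2 * k)) * indicator (lp_ball p n) x \<partial>lebesgue_n n)"
    unfolding set_lebesgue_integral_def
    by (subst integral_eq_nn_integral)
      (auto intro!: arg_cong[where f=enn2real] nn_integral_cong simp: indicator_def)
  also have "\<dots> = ?Z ^ n / ?R * ?G"
    unfolding nn_integral_power_lp_ball[OF p] G using pos
    by (simp add: ennreal_mult[symmetric] Bochner_Integration.integral_nonneg)
  finally have eq: "(LINT x:lp_ball p n|lebesgue_n n. (\<Sum>i<n. a i * x i) ^ (2 * k)) = ?Z ^ n / ?R * ?G" .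
  have "1 / (z / g) * (z / r * y) = g / r * y" if "z \<noteq> 0" for z g r y :: real
    using that by simp
  moreover have "?Z ^ n \<noteq> 0" using pos by simp
  ultimately show ?thesis
    unfolding eq[symmetric] by (subst integral_uniform_lp_ball[OF p]) (simp_all only: eq measure_lp_ball(1)[OF p], measurable)
qed

section \<open>Moment estimates\<close>

lemma powr_mult_of_nat: "x > 0 \<Longrightarrow> x powr (e * real k) = (x powr e) ^ k"
  by (simp add: powr_powr[symmetric] powr_realpow)

text \<open>The constant is \<open>6 = 2 * 3\<close>: \<open>p powr (1 / p) \<le> 2\<close> and
  \<open>exp 1 powr (1 / p) \<le> exp 1 \<le> 3\<close>.\<close>

lemma root_quotient_ge:
  fixes p m :: real assumes p: "p \<ge> 1" and m: "m \<ge> 0"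
  shows "m powr (1 / p) / 6 \<le> (m / p / exp 1) powr (1 / p)"
proof -
  have "exp 1 powr (1 / p) \<le> exp 1 powr (1::real)" using p by (intro powr_mono) auto
  then have "exp 1 powr (1 / p) \<le> (3::real)" using exp_le by simp
  then have "p powr (1 / p) * exp 1 powr (1 / p) \<le> 2 * 3"
    using root_self_le_2[OF p] by (intro mult_mono) auto
  then have "m powr (1 / p) / 6 \<le> m powr (1 / p) / (p powr (1 / p) * exp 1 powr (1 / p))"
    using p by (intro divide_left_mono) auto
  moreover have "(m / p / exp 1) powr (1 / p) = m powr (1 / p) / (p powr (1 / p) * exp 1 powr (1 / p))"
    using p m by (simp add: powr_divide powr_mult)
  ultimately show ?thesis by (simp only:)
qed

text \<open>The Gamma quotient is an increment by \<open>s = 2 * j / p\<close> from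
  \<open>1 / p + 1\<close>. Its endpoint is at most \<open>2 * j + 2 \<le> 4 * j\<close>, and
  \<open>4 powr (2 / p) \<le> 16\<close>.\<close>

lemma gen_normal_moment_upper:
  assumes p: "p \<ge> 1"
  shows "gen_normal_moment p j \<le> (16 * real j powr (2 / p)) ^ j"
proof (cases "j = 0")
  case True
  then show ?thesis using p by simp
next
  case False
  then have j: "real j \<ge> 1" by simp
  define x s where "x = 1 / p + 1" and "s = 2 / p * real j"
  have xs: "x \<ge> 1" "s \<ge> 0" "x + s = (2 * real j + 1) / p + 1"
    using p by (simp_all add: x_def s_def field_simps)
  have g: "Gamma x > 0" using xs by (intro Gamma_real_pos) auto
  have "gen_normal_moment p j = Gamma (x + s) / ((2 * real j + 1) * Gamma x)"
    by (simp add: gen_normal_moment_def xs(3)) (simp add: x_def)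
  also have "\<dots> \<le> Gamma (x + s) / (1 * Gamma x)"
    using g Gamma_real_pos[of "x + s"] xs by (intro divide_left_mono mult_right_mono) auto
  also have "\<dots> \<le> (x + s) powr s" using Gamma_add_bounds(2)[OF xs(1,2)] g by (simp add: field_simps)
  also have "\<dots> \<le> (4 * real j) powr s"
  proof (rule powr_mono2)
    have "(2 * real j + 1) / p \<le> 2 * real j + 1" using p by (simp add: divide_le_eq mult_left_mono)
    then show "x + s \<le> 4 * real j" unfolding xs(3) using j by simp
  qed (use xs in auto)
  also have "\<dots> = (4 powr (2 / p) * real j powr (2 / p)) ^ j"
    unfolding s_def using j by (subst powr_mult_of_nat) (simp_all add: powr_mult)
  also have "\<dots> \<le> (16 * real j powr (2 / p)) ^ j"
  proof (intro power_mono mult_right_mono)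
    have "4 powr (2 / p) \<le> 4 powr (2::real)" using p by (intro powr_mono) (auto simp: field_simps)
    then show "4 powr (2 / p) \<le> (16::real)" by simp
  qed auto
  finally show ?thesis .
qed

text \<open>With \<open>y = (2 * j + 1) / p\<close>, the bound \<open>(y / exp 1) powr y\<close> for
  \<open>Gamma (y + 1)\<close> is the power \<open>2 * j + 1\<close> of a number at least
  \<open>r / 6\<close>, where \<open>r = j powr (1 / p)\<close>. The denominator is controlled by
  \<open>Gamma (1 / p + 1) \<le> 2\<close>.\<close>

lemma gen_normal_moment_lower:
  assumes p: "p \<ge> 1"
  shows "(1 / 1296 * real j powr (2 / p)) ^ j \<le> gen_normal_moment p j"
proof (cases "j = 0")
  case True
  then show ?thesis using p by simp
next
  case False
  then have j: "real j \<ge> 1" by simp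
  define y where "y = (2 * real j + 1) / p"
  have y: "y > 0" using p by (simp add: y_def)
  have g0: "Gamma (1 / p + 1) > 0" using p by (simp add: Gamma_plus1_pos)
  have "Gamma (1 + 1 / p) \<le> (1 + 1 / p) powr (1 / p) * Gamma 1"
    using p by (intro Gamma_add_bounds) auto
  also have "\<dots> \<le> 2 powr (1 / p)" using p by (simp add: powr_mono2)
  also have "\<dots> \<le> 2 powr 1" using p by (intro powr_mono) auto
  finally have g2: "Gamma (1 / p + 1) \<le> 2" by (simp add: add.commute)
  \<comment> \<open>This absorbs the surplus factor \<open>1 / 6\<close> and the denominator
    \<open>(2 * j + 1) * 2\<close> into a second power of 36, whence
    \<open>1296 = 36 * 36\<close>.\<close>
  have six: "12 * (2 * real m + 1) \<le> 36 ^ m" if "m \<ge> 1" for m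
    using that by (induction m rule: nat_induct_at_least) auto
  define r where "r = real j powr (1 / p)"
  have r: "r \<ge> 1" using j p by (simp add: r_def ge_one_powr_ge_zero)
  have r2: "real j powr (2 / p) = r\<^sup>2"
    using j by (simp add: r_def power2_eq_square powr_add[symmetric])
  have "(1 / 1296 * real j powr (2 / p)) ^ j = (r\<^sup>2) ^ j / (36 ^ j * 36 ^ j)"
    by (simp add: r2 power_divide power_mult_distrib[symmetric])
  also have "\<dots> \<le> (r\<^sup>2) ^ j / (36 ^ j * (12 * (2 * real j + 1)))"
    using six[of j] j by (intro divide_left_mono mult_left_mono) auto
  also have "\<dots> = (r / 6) ^ (2 * j) * (1 / 6) / ((2 * real j + 1) * 2)"
  proof -
    have "(r / 6) ^ (2 * j) = (r\<^sup>2) ^ j / 36 ^ j" by (simp add: power_mult power_divide)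
    then show ?thesis by simp
  qed
  also have "\<dots> \<le> (r / 6) ^ (2 * j) * (r / 6) / ((2 * real j + 1) * 2)"
    using r by (intro divide_right_mono mult_left_mono) auto
  also have "\<dots> = (r / 6) ^ (2 * j + 1) / ((2 * real j + 1) * 2)" by simp
  also have "\<dots> \<le> ((y / exp 1) powr (1 / p)) ^ (2 * j + 1) / ((2 * real j + 1) * 2)"
  proof (intro divide_right_mono power_mono)
    have "r / 6 \<le> (2 * real j + 1) powr (1 / p) / 6"
      unfolding r_def using p by (intro divide_right_mono powr_mono2) auto
    also have "\<dots> \<le> (y / exp 1) powr (1 / p)"
      unfolding y_def using p by (intro root_quotient_ge) auto
    finally show "r / 6 \<le> (y / exp 1) powr (1 / p)" .
  qed (use r in auto)
  also have "((y / exp 1) powr (1 / p)) ^ (2 * j + 1) = (y / exp 1) powr y"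
    using divide_pos_pos[OF y, of "exp 1"] by (subst powr_mult_of_nat[symmetric]) (auto simp: y_def add.commute)
  also have "(y / exp 1) powr y / ((2 * real j + 1) * 2) \<le> Gamma (y + 1) / ((2 * real j + 1) * Gamma (1 / p + 1))"
    using Gamma_plus1_ge[OF y] g0 g2 Gamma_plus1_pos[of y] y by (intro frac_le mult_left_mono) auto
  finally show ?thesis by (simp add: gen_normal_moment_def y_def)
qed

text \<open>An increment by \<open>s = 2 * k / p\<close> from \<open>x = n / p + 1\<close>. For
  \<open>k \<le> n\<close> the endpoint \<open>x + s\<close> is at most
  \<open>n + 2 * k + 1 \<le> 4 * n\<close>; the lower bound compares \<open>x\<close> with
  \<open>n / p\<close> and holds for all \<open>k\<close>.\<close>

lemma Gamma_ratio_bounds: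
  fixes p :: real and n k :: nat assumes p: "p \<ge> 1" and n: "n \<ge> 1"
  defines "R \<equiv> Gamma ((real n + 2 * real k) / p + 1) / Gamma (real n / p + 1)"
  shows "(real n powr (2 / p) / 36) ^ k \<le> R"
    and "k \<le> n \<Longrightarrow> R \<le> (16 * real n powr (2 / p)) ^ k"
proof -
  define x s where "x = real n / p + 1" and "s = 2 / p * real k"
  have xs: "x \<ge> 1" "s \<ge> 0" "x + s = (real n + 2 * real k) / p + 1"
    using p by (simp_all add: x_def s_def field_simps)
  have g: "Gamma x > 0" using xs by (intro Gamma_real_pos) auto
  have R: "R = Gamma (x + s) / Gamma x" by (simp add: R_def xs(3)) (simp add: x_def)
  have sq: "y powr (2 / p) = (y powr (1 / p))\<^sup>2" if "y > 0" for y :: real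
    using that by (simp add: power2_eq_square powr_add[symmetric])
  have "(real n powr (2 / p) / 36) ^ k = ((real n powr (1 / p) / 6)\<^sup>2) ^ k"
    using n by (simp add: sq power_divide)
  also have "\<dots> \<le> (((real n / p / exp 1) powr (1 / p))\<^sup>2) ^ k"
    using p by (intro power_mono root_quotient_ge) auto
  also have "\<dots> \<le> (((x / exp 1) powr (1 / p))\<^sup>2) ^ k"
    using p by (intro power_mono powr_mono2 divide_right_mono) (auto simp: x_def)
  also have "\<dots> = (x / exp 1) powr s"
    unfolding s_def using xs by (subst powr_mult_of_nat) (simp_all add: sq)
  also have "\<dots> \<le> R" unfolding R using Gamma_add_bounds(1)[OF xs(1,2)] g by (simp add: field_simps)
  finally show "(real n powr (2 / p) / 36) ^ k \<le> R" .
  assume kn: "k \<le> n"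
  have "R \<le> (x + s) powr s" unfolding R using Gamma_add_bounds(2)[OF xs(1,2)] g by (simp add: field_simps)
  also have "\<dots> \<le> (4 * real n) powr s"
  proof (rule powr_mono2)
    have "(real n + 2 * real k) / p \<le> real n + 2 * real k" using p by (simp add: divide_le_eq mult_le_cancel_left1)
    then show "x + s \<le> 4 * real n" unfolding xs(3) using n kn by simp
  qed (use xs in auto)
  also have "\<dots> = (4 powr (2 / p) * real n powr (2 / p)) ^ k"
    unfolding s_def using n by (subst powr_mult_of_nat) (simp_all add: powr_mult)
  also have "\<dots> \<le> (16 * real n powr (2 / p)) ^ k"
  proof (intro power_mono mult_right_mono)
    have "4 powr (2 / p) \<le> 4 powr (2::real)" using p by (intro powr_mono) (auto simp: field_simps)
    then show "4 powr (2 / p) \<le> (16::real)" by simp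
  qed auto
  finally show "R \<le> (16 * real n powr (2 / p)) ^ k" .
qed

text \<open>The quotient of \<open>fact (2 * k)\<close> by \<open>fact k\<close> has
  \<open>k\<close> factors between \<open>k\<close> and \<open>2 * k\<close>. The third bound is
  \<open>(2 * k / exp 1) ^ (2 * k) \<le> fact (2 * k)\<close> with \<open>exp 1\<close> replaced by
  4.\<close>

lemma fact_double_bounds:
  "fact k * real k ^ k \<le> fact (2 * k)" "fact (2 * k) \<le> fact k * (2 * real k) ^ k"
  "((real k)\<^sup>2 / 4) ^ k \<le> fact (2 * k)"
proof -
  have pr: "fact (2 * k) = fact k * (\<Prod>i\<in>{k+1..2*k}. real i)"
  proof -
    have "fact (2 * k) = (\<Prod>i\<in>{1..k} \<union> {k+1..2*k}. real i)"
      unfolding fact_prod of_nat_prod by (intro prod.cong) auto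
    also have "\<dots> = (\<Prod>i\<in>{1..k}. real i) * (\<Prod>i\<in>{k+1..2*k}. real i)"
      by (intro prod.union_disjoint) auto
    finally show ?thesis by (simp add: fact_prod)
  qed
  have "real k ^ k \<le> (\<Prod>i\<in>{k+1..2*k}. real i)"
    using prod_mono[of "{k+1..2*k}" "\<lambda>_. real k" real] by simp
  then show "fact k * real k ^ k \<le> fact (2 * k)" unfolding pr by (intro mult_left_mono) auto
  have "(\<Prod>i\<in>{k+1..2*k}. real i) \<le> (2 * real k) ^ k"
    using prod_mono[of "{k+1..2*k}" real "\<lambda>_. 2 * real k"] by simp
  then show "fact (2 * k) \<le> fact k * (2 * real k) ^ k" unfolding pr by (intro mult_left_mono) auto
  show "((real k)\<^sup>2 / 4) ^ k \<le> fact (2 * k)"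
  proof (cases "k = 0")
    case False
    have "((real k)\<^sup>2 / 4) ^ k = (real k / 2) ^ (2 * k)"
      by (simp add: power_mult power_divide)
    also have "\<dots> \<le> (real (2 * k) / exp 1) ^ (2 * k)"
    proof (rule power_mono)
      have "real k / 2 = real (2 * k) / 4" by simp
      also have "\<dots> \<le> real (2 * k) / exp 1" using exp_le by (intro divide_left_mono) auto
      finally show "real k / 2 \<le> real (2 * k) / exp 1" .
    qed simp
    also have "\<dots> = (real (2 * k) / exp 1) powr real (2 * k)"
      using False by (subst powr_realpow) auto
    also have "\<dots> \<le> Gamma (real (2 * k) + 1)" using False by (intro Gamma_plus1_ge) simp
    also have "\<dots> = fact (2 * k)" using Gamma_fact[of "2 * k", where ?'a = real] by (simp add: add.commute)
    finally show ?thesis .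
  qed simp
qed

section \<open>Moments of linear forms in the independent variables and on the ball\<close>

definition gen_normal_sum_moment :: "real \<Rightarrow> nat \<Rightarrow> (nat \<Rightarrow> real) \<Rightarrow> nat \<Rightarrow> real" where
  "gen_normal_sum_moment p n a k = (LINT x|gen_normal_n p n. (\<Sum>i<n. a i * x i) ^ (2 * k))"

lemma gen_normal_sum_moment_nonneg: "0 \<le> gen_normal_sum_moment p n a k"
  unfolding gen_normal_sum_moment_def by (intro Bochner_Integration.integral_nonneg) auto

text \<open>This replaces the power \<open>e\<close> of \<open>j\<close> by a linear function of
  \<open>j\<close> whose slope depends on \<open>k\<close> alone. Only then do the moments of one
  variable fit the Gaussian pattern \<open>(D * j) ^ j\<close>.\<close>

lemma powr_of_nat_le:
  fixes j k :: nat and e :: real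
  assumes "j \<le> k" shows "real j powr e \<le> real k powr (max 1 e - 1) * real j"
proof (cases "j = 0")
  case False
  then have j: "real j \<ge> 1" by simp
  have "real j powr e = real j powr (e - 1) * real j"
    using j by (simp add: powr_diff)
  also have "real j powr (e - 1) \<le> real j powr (max 1 e - 1)" using j by (intro powr_mono) auto
  also have "\<dots> \<le> real k powr (max 1 e - 1)" using j assms by (intro powr_mono2) auto
  finally show ?thesis using j by simp
qed simp

lemma powr_of_nat_ge:
  fixes j k :: nat and e :: real
  assumes "j \<le> k" shows "real k powr (min 1 e - 1) * real j \<le> real j powr e"
proof (cases "j = 0")
  case False
  then have j: "real j \<ge> 1" by simp
  have "real k powr (min 1 e - 1) \<le> real j powr (min 1 e - 1)" using j assms by (intro powr_mono2') auto
  also have "\<dots> \<le> real j powr (e - 1)" using j by (intro powr_mono) auto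
  finally have "real k powr (min 1 e - 1) * real j \<le> real j powr (e - 1) * real j"
    using j by simp
  also have "\<dots> = real j powr e" using j by (simp add: powr_diff)
  finally show ?thesis .
qed simp

context
  fixes p :: real and n :: nat
  assumes p: "p \<ge> 1" and n: "n \<ge> 1"
begin

lemma gen_normal_sum_moment_0: "gen_normal_sum_moment p n a 0 = 1"
proof -
  interpret prob_space "gen_normal_n p n" using p by (intro prob_space_gen_normal_n) auto
  show ?thesis by (simp add: gen_normal_sum_moment_def prob_space)
qed

lemma gen_normal_sum_moment_general:
  shows "gen_normal_sum_moment p n a k \<le> (32 * real k powr max 1 (2 / p) * (\<Sum>i<n. (a i)\<^sup>2)) ^ k"
    and "(1 / 2592 * real k powr min 1 (2 / p) * (\<Sum>i<n. (a i)\<^sup>2)) ^ k \<le> gen_normal_sum_moment p n a k"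
proof -
  have p0: "p > 0" using p by simp
  interpret indep_symmetric "gen_normal_n p n" "\<lambda>i x. a i * x i" "{..<n}"
    using p0 n by (intro indep_symmetric_gen_normal_n) auto
  define s where "s = (\<Sum>i<n. (a i)\<^sup>2)"
  have s: "s \<ge> 0" by (simp add: s_def sum_nonneg)
  have total: "gen_normal_sum_moment p n a k = fact (2 * k) * even_moment {..<n} k"
    by (simp add: gen_normal_sum_moment_def even_moment_def)
  have single: "even_moment {i} j = ((a i)\<^sup>2) ^ j * gen_normal_moment p j / fact (2 * j)" if "i < n" for i j
  proof -
    have "expectation (\<lambda>x. (a i * x i) ^ (2 * j)) = (LINT t|gen_normal p. (a i * t) ^ (2 * j))"
      using integral_gen_normal_n_component(2)[OF p0 that, of "\<lambda>t. (a i * t) ^ (2 * j)"] by simp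
    also have "\<dots> = a i ^ (2 * j) * gen_normal_moment p j"
      by (simp add: power_mult_distrib gen_normal_power(2)[OF p0])
    finally show ?thesis by (simp add: even_moment_def power_mult[of "a i"])
  qed
  show "gen_normal_sum_moment p n a k \<le> (32 * real k powr max 1 (2 / p) * (\<Sum>i<n. (a i)\<^sup>2)) ^ k"
  proof (cases "k = 0")
    case False
    \<comment> \<open>The smallest slope supplied by the linearisation for which
      \<open>16 * j powr (2 / p) \<le> D * j\<close> up to \<open>j = k\<close>. The final 32 is 16
      times the 2 from \<open>fact (2 * k) \<le> fact k * (2 * k) ^ k\<close>.\<close>
    define D where "D = 16 * real k powr (max 1 (2 / p) - 1)"
    have D: "D \<ge> 0" by (simp add: D_def)
    have "even_moment {..<n} k \<le> (\<Sum>i<n. (a i)\<^sup>2 * D) ^ k / fact k"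
    proof (rule even_moment_le_gaussian)
      fix i j assume "i \<in> {..<n}" and jk: "j \<le> k"
      then have i: "i < n" by simp
      have "gen_normal_moment p j \<le> (16 * real j powr (2 / p)) ^ j" by (rule gen_normal_moment_upper[OF p])
      also have "\<dots> \<le> (D * real j) ^ j"
        using powr_of_nat_le[OF jk, of "2 / p"] by (intro power_mono) (auto simp: D_def)
      also have "\<dots> = D ^ j * (fact j * real j ^ j) / fact j" by (simp add: power_mult_distrib)
      also have "\<dots> \<le> D ^ j * fact (2 * j) / fact j"
        using D by (intro divide_right_mono mult_left_mono fact_double_bounds) auto
      finally have "((a i)\<^sup>2) ^ j * gen_normal_moment p j / fact (2 * j) \<le>
          ((a i)\<^sup>2) ^ j * (D ^ j * fact (2 * j) / fact j) / fact (2 * j)"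
        by (intro divide_right_mono mult_left_mono) auto
      then show "even_moment {i} j \<le> ((a i)\<^sup>2 * D) ^ j / fact j"
        by (simp add: single[OF i] power_mult_distrib)
    qed (use D in auto)
    also have "(\<Sum>i<n. (a i)\<^sup>2 * D) = s * D" by (simp add: s_def sum_distrib_right)
    finally have "gen_normal_sum_moment p n a k \<le> fact (2 * k) * ((s * D) ^ k / fact k)"
      unfolding total by (intro mult_left_mono) auto
    also have "\<dots> \<le> fact k * (2 * real k) ^ k * ((s * D) ^ k / fact k)"
      using s D by (intro mult_right_mono fact_double_bounds) auto
    also have "\<dots> = (2 * real k * (s * D)) ^ k" by (simp add: power_mult_distrib)
    also have "2 * real k * (s * D) = 32 * real k powr max 1 (2 / p) * s"
      using False by (simp add: D_def powr_diff)
    finally show ?thesis by (simp add: s_def)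
  qed (simp add: gen_normal_sum_moment_0)
  show "(1 / 2592 * real k powr min 1 (2 / p) * (\<Sum>i<n. (a i)\<^sup>2)) ^ k \<le> gen_normal_sum_moment p n a k"
  proof (cases "k = 0")
    case False
    \<comment> \<open>Half of the constant \<open>1 / 1296\<close>, because
      \<open>fact (2 * j) \<le> fact j * (2 * j) ^ j\<close> produces \<open>2 * d\<close>.\<close>
    define d where "d = 1 / 2592 * real k powr (min 1 (2 / p) - 1)"
    have d: "d \<ge> 0" by (simp add: d_def)
    have "1 / 2592 * real k powr min 1 (2 / p) * s = real k * (s * d)"
      using False by (simp add: d_def powr_diff)
    then have "(1 / 2592 * real k powr min 1 (2 / p) * s) ^ k = (real k * (s * d)) ^ k"
      by (rule arg_cong)
    also have "\<dots> = real k ^ k * (s * d) ^ k" by (rule power_mult_distrib)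
    also have "\<dots> = fact k * real k ^ k * ((s * d) ^ k / fact k)" by simp
    also have "\<dots> \<le> fact (2 * k) * ((s * d) ^ k / fact k)"
      using s d by (intro mult_right_mono fact_double_bounds) auto
    also have "s * d = (\<Sum>i<n. (a i)\<^sup>2 * d)" by (simp add: s_def sum_distrib_right)
    also have "(\<Sum>i<n. (a i)\<^sup>2 * d) ^ k / fact k \<le> even_moment {..<n} k"
    proof (rule even_moment_ge_gaussian)
      fix i j assume "i \<in> {..<n}" and jk: "j \<le> k"
      then have i: "i < n" by simp
      have "d ^ j * fact (2 * j) / fact j \<le> d ^ j * (fact j * (2 * real j) ^ j) / fact j"
        using d by (intro divide_right_mono mult_left_mono fact_double_bounds) auto
      also have "\<dots> = (2 * d * real j) ^ j" by (simp add: power_mult_distrib)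
      also have "\<dots> \<le> (1 / 1296 * real j powr (2 / p)) ^ j"
        using powr_of_nat_ge[OF jk, of "2 / p"] by (intro power_mono) (auto simp: d_def)
      also have "\<dots> \<le> gen_normal_moment p j" by (rule gen_normal_moment_lower[OF p])
      finally have "((a i)\<^sup>2) ^ j * (d ^ j * fact (2 * j) / fact j) / fact (2 * j) \<le>
          ((a i)\<^sup>2) ^ j * gen_normal_moment p j / fact (2 * j)"
        by (intro divide_right_mono mult_left_mono) auto
      then show "((a i)\<^sup>2 * d) ^ j / fact j \<le> even_moment {i} j"
        by (simp add: single[OF i] power_mult_distrib)
    qed (use d in auto)
    finally show ?thesis unfolding total s_def by simp
  qed (simp add: gen_normal_sum_moment_0)
qed

text \<open>Spreading over all coordinates gives the Gaussian order \<open>(k * n) ^ k\<close> for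
  every \<open>p\<close>, as long as \<open>k \<le> n\<close>. The upper bound needs only moments of
  exponential growth, at most \<open>64 ^ j * fact (2 * j)\<close>; the lower bound needs only
  second moments.\<close>

lemma gen_normal_sum_moment_ones:
  assumes k: "k \<le> n"
  shows "gen_normal_sum_moment p n (\<lambda>_. 1) k \<le> (256 * real k * real n) ^ k"
    and "(1 / 10368 * real k * real n) ^ k \<le> gen_normal_sum_moment p n (\<lambda>_. 1) k"
proof -
  have p0: "p > 0" using p by simp
  interpret indep_symmetric "gen_normal_n p n" "\<lambda>i x. x i" "{..<n}"
    using indep_symmetric_gen_normal_n[OF p0, of n "\<lambda>_. 1"] n by simp
  have total: "gen_normal_sum_moment p n (\<lambda>_. 1) k = fact (2 * k) * even_moment {..<n} k"
    by (simp add: gen_normal_sum_moment_def even_moment_def)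
  have single: "even_moment {i} j = gen_normal_moment p j / fact (2 * j)" if "i < n" for i j
    using integral_gen_normal_n_component(2)[OF p0 that, of "\<lambda>t. t ^ (2 * j)"]
    by (simp add: even_moment_def gen_normal_power(2)[OF p0])
  have "even_moment {..<n} k \<le> 64 ^ k * real (card {..<n} + k choose k)"
  proof (rule even_moment_le_geometric)
    fix i j assume "i \<in> {..<n}"
    then have i: "i < n" by simp
    have "gen_normal_moment p j \<le> (16 * real j powr (2 / p)) ^ j" by (rule gen_normal_moment_upper[OF p])
    \<comment> \<open>Since \<open>2 / p \<le> 2\<close>, the worst growth is \<open>j ^ 2\<close>;
      the factor 4 taken out prepares the third bound for \<open>fact (2 * j)\<close>.\<close>
    also have "\<dots> \<le> (64 * ((real j)\<^sup>2 / 4)) ^ j"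
    proof (cases "j = 0")
      case False
      have "real j powr (2 / p) \<le> real j powr 2" using False p by (intro powr_mono) (auto simp: field_simps)
      then show ?thesis using False by (intro power_mono) (simp_all add: powr_numeral)
    qed simp
    also have "\<dots> = 64 ^ j * ((real j)\<^sup>2 / 4) ^ j" by (rule power_mult_distrib)
    also have "\<dots> \<le> 64 ^ j * fact (2 * j)" by (intro mult_left_mono fact_double_bounds) auto
    finally show "even_moment {i} j \<le> 64 ^ j" by (simp add: single[OF i] divide_le_eq)
  qed auto
  then have "gen_normal_sum_moment p n (\<lambda>_. 1) k \<le> fact (2 * k) * (64 ^ k * real (n + k choose k))"
    unfolding total by (intro mult_left_mono) auto
  also have "\<dots> \<le> fact k * (2 * real k) ^ k * (64 ^ k * real (n + k choose k))"
    by (intro mult_right_mono fact_double_bounds) auto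
  also have "\<dots> = (2 * real k) ^ k * 64 ^ k * real ((n + k choose k) * fact k)" by simp
  also have "\<dots> \<le> (2 * real k) ^ k * 64 ^ k * real ((n + k) ^ k)"
    using binomial_fact_pow[of "n + k" k] by (intro mult_left_mono of_nat_mono) auto
  also have "\<dots> \<le> (2 * real k) ^ k * 64 ^ k * (2 * real n) ^ k"
  proof (rule mult_left_mono)
    show "real ((n + k) ^ k) \<le> (2 * real n) ^ k"
      unfolding of_nat_power using k by (intro power_mono) simp_all
  qed simp
  also have "\<dots> = (256 * real k * real n) ^ k"
  proof -
    have "256 * real k * real n = 2 * real k * 64 * (2 * real n)" by simp
    then show ?thesis by (simp only: power_mult_distrib)
  qed
  finally show "gen_normal_sum_moment p n (\<lambda>_. 1) k \<le> (256 * real k * real n) ^ k" .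
  show "(1 / 10368 * real k * real n) ^ k \<le> gen_normal_sum_moment p n (\<lambda>_. 1) k"
  proof (cases "k = 0")
    case False
    \<comment> \<open>Here \<open>10368 = 4 * 2592\<close>: the 4 comes from the factorial bound,
      and \<open>n / k\<close> from the binomial coefficient
      \<open>n choose k \<ge> (n / k) ^ k\<close>.\<close>
    have "1 / 10368 * real k * real n = (real k)\<^sup>2 / 4 * (1 / 2592 * (real n / real k))"
      using False by (simp add: power2_eq_square)
    then have "(1 / 10368 * real k * real n) ^ k = ((real k)\<^sup>2 / 4) ^ k * ((1 / 2592) ^ k * (real n / real k) ^ k)"
      by (simp only: power_mult_distrib)
    also have "\<dots> \<le> fact (2 * k) * ((1 / 2592) ^ k * real (card {..<n} choose k))"
      using binomial_ge_n_over_k_pow_k[OF k, where ?'a = real]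
      by (intro mult_mono fact_double_bounds mult_left_mono) auto
    also have "\<dots> \<le> fact (2 * k) * even_moment {..<n} k"
    proof (intro mult_left_mono even_moment_ge_choose)
      fix i assume "i \<in> {..<n}"
      then have i: "i < n" by simp
      show "1 / 2592 \<le> even_moment {i} 1"
        using gen_normal_moment_lower[OF p, of 1] by (simp only: single[OF i]) (simp add: field_simps fact_numeral)
    qed auto
    finally show ?thesis unfolding total .
  qed (simp add: gen_normal_sum_moment_0)
qed

lemma gen_normal_sum_moment_unit:
  "gen_normal_sum_moment p n (\<lambda>i. if i = 0 then 1 else 0) k = gen_normal_moment p k"
proof -
  have "(\<Sum>i<n. (if i = 0 then 1 else 0) * x i) = x 0" for x :: "nat \<Rightarrow> real"
    using n by (simp add: if_distrib[of "\<lambda>u. u * _"] cong: if_cong)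
  then show ?thesis
    using integral_gen_normal_n_component(2)[of p 0 n "\<lambda>t. t ^ (2 * k)"] n p gen_normal_power(2)[of p k]
    by (simp add: gen_normal_sum_moment_def)
qed

lemma uniform_lp_ball_moment_le:
  assumes "gen_normal_sum_moment p n a k \<le> C ^ k"
  shows "(LINT x|uniform_lp_ball p n. (\<Sum>i<n. a i * x i) ^ (2 * k)) \<le> (36 * C / real n powr (2 / p)) ^ k"
proof -
  define R where "R = Gamma ((real n + 2 * real k) / p + 1) / Gamma (real n / p + 1)"
  have R: "(real n powr (2 / p) / 36) ^ k \<le> R" unfolding R_def by (rule Gamma_ratio_bounds(1)[OF p n])
  have r: "(real n powr (2 / p) / 36) ^ k > 0" using n by simp
  have "(LINT x|uniform_lp_ball p n. (\<Sum>i<n. a i * x i) ^ (2 * k)) = gen_normal_sum_moment p n a k / R"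
    using p n by (subst uniform_lp_ball_power) (auto simp: R_def gen_normal_sum_moment_def)
  also have "\<dots> \<le> C ^ k / (real n powr (2 / p) / 36) ^ k"
    using R r order_trans[OF gen_normal_sum_moment_nonneg assms] assms by (intro frac_le) auto
  finally show ?thesis using n by (simp add: power_divide power_mult_distrib field_simps)
qed

lemma uniform_lp_ball_moment_ge:
  assumes "c ^ k \<le> gen_normal_sum_moment p n a k" "c \<ge> 0" "k \<le> n"
  shows "(1 / 16 * c / real n powr (2 / p)) ^ k \<le> (LINT x|uniform_lp_ball p n. (\<Sum>i<n. a i * x i) ^ (2 * k))"
proof -
  define R where "R = Gamma ((real n + 2 * real k) / p + 1) / Gamma (real n / p + 1)"
  have R: "R \<le> (16 * real n powr (2 / p)) ^ k" unfolding R_def by (rule Gamma_ratio_bounds(2)[OF p n assms(3)])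
  have R0: "R > 0" unfolding R_def using p by (intro divide_pos_pos Gamma_plus1_pos) auto
  have "(1 / 16 * c / real n powr (2 / p)) ^ k = c ^ k / (16 * real n powr (2 / p)) ^ k"
    by (simp add: power_divide)
  also have "\<dots> \<le> gen_normal_sum_moment p n a k / R"
    using assms R R0 by (intro frac_le gen_normal_sum_moment_nonneg) auto
  also have "\<dots> = (LINT x|uniform_lp_ball p n. (\<Sum>i<n. a i * x i) ^ (2 * k))"
    using p n by (subst uniform_lp_ball_power) (auto simp: R_def gen_normal_sum_moment_def)
  finally show ?thesis .
qed

end

section \<open>Elementary comparison of moments\<close>

lemma powr_le_one_plus_powr:
  fixes u r s :: real assumes "0 \<le> r" "r \<le> s" "0 \<le> u"
  shows "u powr r \<le> 1 + u powr s"
proof (cases "u \<le> 1")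
  case True
  then have "u powr r \<le> 1" using assms by (intro powr_le1) auto
  then show ?thesis using powr_ge_zero[of u s] by linarith
next
  case False
  then have "u powr r \<le> u powr s" using assms by (intro powr_mono) auto
  then show ?thesis by simp
qed

lemma abs_powr_even: "k > 0 \<Longrightarrow> \<bar>y\<bar> powr real (2 * k) = y ^ (2 * k)" for y :: real
proof (cases "y = 0")
  case False
  then have "\<bar>y\<bar> powr real (2 * k) = \<bar>y\<bar> ^ (2 * k)" by (subst powr_realpow) auto
  then show ?thesis by (simp add: power_even_abs)
qed simp

text \<open>Integrating \<open>u powr r \<le> 1 + u powr s\<close> with \<open>u = T / N\<close>
  serves in place of Jensen's inequality, at the cost of a factor 2.\<close>

lemma (in prob_space) expectation_powr_le:
  fixes T :: "'a \<Rightarrow> real"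
  assumes r: "0 \<le> r" "r \<le> s" and N: "N > 0" and T: "\<And>x. 0 \<le> T x"
    and int: "integrable M (\<lambda>x. T x powr r)" "integrable M (\<lambda>x. T x powr s)"
    and le: "expectation (\<lambda>x. T x powr s) \<le> N powr s"
  shows "expectation (\<lambda>x. T x powr r) \<le> 2 * N powr r"
proof -
  have "T x powr r \<le> N powr r + N powr r / N powr s * T x powr s" for x
    using powr_le_one_plus_powr[OF r, of "T x / N"] N T[of x]
    by (simp add: powr_divide field_simps)
  then have "expectation (\<lambda>x. T x powr r) \<le> expectation (\<lambda>x. N powr r + N powr r / N powr s * T x powr s)"
    using int by (intro integral_mono) auto
  also have "\<dots> = N powr r + N powr r / N powr s * expectation (\<lambda>x. T x powr s)"
    using int by (simp add: prob_space)
  also have "\<dots> \<le> N powr r + N powr r / N powr s * N powr s"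
    using le by (intro add_left_mono mult_left_mono) auto
  finally show ?thesis using N by simp
qed

text \<open>Integrate \<open>T\<^sup>2 \<le> l T + T\<^sup>4 / l\<^sup>2\<close> with \<open>l\<^sup>2 = 2 B / A\<close>.\<close>
lemma (in prob_space) expectation_ge_of_moments:
  fixes T :: "'a \<Rightarrow> real"
  assumes T: "\<And>x. 0 \<le> T x"
    and int: "integrable M T" "integrable M (\<lambda>x. T x ^ 2)" "integrable M (\<lambda>x. T x ^ 4)"
    and A: "0 < A" "A \<le> expectation (\<lambda>x. T x ^ 2)"
    and B: "0 < B" "expectation (\<lambda>x. T x ^ 4) \<le> B"
  shows "A ^ 3 / (8 * B) \<le> (expectation T)\<^sup>2"
proof -
  define l where "l = sqrt (2 * B / A)"
  have l: "l > 0" "l\<^sup>2 = 2 * B / A" using A B by (simp_all add: l_def)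
  have "T x ^ 2 \<le> l * T x + T x ^ 4 / l\<^sup>2" for x
  proof (cases "T x \<le> l")
    case True
    then have "T x ^ 2 \<le> l * T x" using T[of x] by (simp add: power2_eq_square mult_right_mono)
    moreover have "0 \<le> T x ^ 4 / l\<^sup>2" by simp
    ultimately show ?thesis by linarith
  next
    case False
    then have "l\<^sup>2 \<le> T x ^ 2" using l by (intro power_mono) auto
    then have "l\<^sup>2 * T x ^ 2 \<le> T x ^ 2 * T x ^ 2" by (intro mult_right_mono) auto
    moreover have "T x ^ 2 * T x ^ 2 = T x ^ 4" by (simp add: power_add[symmetric])
    ultimately have "T x ^ 2 \<le> T x ^ 4 / l\<^sup>2" using zero_less_power[OF l(1), of 2] by (simp only: pos_le_divide_eq mult.commute)
    then show ?thesis using l T[of x] by (simp add: add_increasing)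
  qed
  then have "expectation (\<lambda>x. T x ^ 2) \<le> expectation (\<lambda>x. l * T x + T x ^ 4 / l\<^sup>2)"
    using int by (intro integral_mono) auto
  also have "\<dots> = l * expectation T + expectation (\<lambda>x. T x ^ 4) / l\<^sup>2" using int by simp
  also have "\<dots> \<le> l * expectation T + B / l\<^sup>2" using B by (intro add_left_mono divide_right_mono) auto
  also have "B / l\<^sup>2 = A / 2" using A B by (simp add: l field_simps)
  finally have "A / 2 \<le> l * expectation T" using A by linarith
  then have "(A / 2)\<^sup>2 \<le> (l * expectation T)\<^sup>2" using A by (intro power_mono) auto
  also have "\<dots> = 2 * B / A * (expectation T)\<^sup>2" by (simp add: power_mult_distrib l)
  finally show ?thesis using A B by (simp add: field_simps power2_eq_square power3_eq_cube)
qed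

section \<open>Pointwise bounds on the ball\<close>

lemma lp_ball_coordinate_le:
  assumes "p > 0" "x \<in> lp_ball p n" "i < n"
  shows "\<bar>x i\<bar> \<le> 1"
proof (rule ccontr)
  assume "\<not> \<bar>x i\<bar> \<le> 1"
  then have "1 powr p < \<bar>x i\<bar> powr p" using assms by (intro powr_less_mono2) auto
  also have "\<dots> \<le> (\<Sum>i<n. \<bar>x i\<bar> powr p)" using assms by (intro member_le_sum) auto
  finally show False using assms by (simp add: lp_ball_def)
qed

text \<open>Hoelder's inequality up to a factor 2: apply \<open>u powr r \<le> 1 + u powr p\<close>
  to \<open>u = n powr (1 / p) * \<bar>x i\<bar>\<close> and sum; each of the two terms contributes
  at most \<open>n\<close>.\<close>

lemma lp_ball_sum_powr_le:
  assumes p: "p > 0" and x: "x \<in> lp_ball p n" and r: "0 \<le> r" "r \<le> p" and n: "n \<ge> 1"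
  shows "(\<Sum>i<n. \<bar>x i\<bar> powr r) \<le> 2 * real n powr (1 - r / p)"
proof -
  have "\<bar>x i\<bar> powr r \<le> real n powr (- r / p) * (1 + real n * \<bar>x i\<bar> powr p)" for i
  proof -
    have "(real n powr (1 / p) * \<bar>x i\<bar>) powr r \<le> 1 + (real n powr (1 / p) * \<bar>x i\<bar>) powr p"
      using r by (intro powr_le_one_plus_powr) auto
    then have "real n powr (r / p) * \<bar>x i\<bar> powr r \<le> 1 + real n * \<bar>x i\<bar> powr p"
      using p by (simp add: powr_mult powr_powr)
    then have "real n powr (- r / p) * (real n powr (r / p) * \<bar>x i\<bar> powr r) \<le>
        real n powr (- r / p) * (1 + real n * \<bar>x i\<bar> powr p)"
      by (intro mult_left_mono) auto
    moreover have "real n powr (- r / p) * real n powr (r / p) = 1"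
      using n by (simp add: powr_add[symmetric])
    ultimately show ?thesis by (simp add: mult.assoc[symmetric])
  qed
  then have "(\<Sum>i<n. \<bar>x i\<bar> powr r) \<le> (\<Sum>i<n. real n powr (- r / p) * (1 + real n * \<bar>x i\<bar> powr p))"
    by (intro sum_mono)
  also have "\<dots> = real n powr (- r / p) * (real n + real n * (\<Sum>i<n. \<bar>x i\<bar> powr p))"
    by (simp add: sum_distrib_left[symmetric] sum.distrib)
  also have "\<dots> \<le> real n powr (- r / p) * (real n + real n * 1)"
    using x by (intro mult_left_mono add_left_mono) (auto simp: lp_ball_def)
  also have "\<dots> = 2 * (real n powr 1 * real n powr (- r / p))" using n by simp
  also have "\<dots> = 2 * real n powr (1 - r / p)" by (simp only: powr_add[symmetric]) simp
  finally show ?thesis .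
qed

text \<open>Cauchy-Schwarz with the Euclidean radius of the ball. For \<open>p < 2\<close> that
  radius is at most 1; for \<open>p \<ge> 2\<close> its square is at most
  \<open>2 * n powr (1 - 2 / p)\<close>. The maximum merges the two cases.\<close>

lemma lp_ball_linear_le:
  assumes p: "p \<ge> 1" and x: "x \<in> lp_ball p n" and n: "n \<ge> 1"
  shows "(\<Sum>i<n. a i * x i)\<^sup>2 \<le> 2 * real n powr max 1 (2 / p) / real n powr (2 / p) * (\<Sum>i<n. (a i)\<^sup>2)"
proof -
  have "(\<Sum>i<n. (x i)\<^sup>2) \<le> 2 * real n powr (max 1 (2 / p) - 2 / p)"
  proof (cases "p \<ge> 2")
    case True
    have "(\<Sum>i<n. (x i)\<^sup>2) = (\<Sum>i<n. \<bar>x i\<bar> powr 2)" by (simp add: powr_numeral)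
    also have "\<dots> \<le> 2 * real n powr (1 - 2 / p)" using True x n by (intro lp_ball_sum_powr_le) auto
    also have "1 = max 1 (2 / p)" using True by simp
    finally show ?thesis .
  next
    case False
    have "(\<Sum>i<n. (x i)\<^sup>2) \<le> (\<Sum>i<n. \<bar>x i\<bar> powr p)"
    proof (intro sum_mono)
      fix i assume "i \<in> {..<n}"
      then have "\<bar>x i\<bar> \<le> 1" using lp_ball_coordinate_le[of p x n i] p x by auto
      then have "\<bar>x i\<bar> powr 2 \<le> \<bar>x i\<bar> powr p" using False by (intro powr_mono') auto
      then show "(x i)\<^sup>2 \<le> \<bar>x i\<bar> powr p" by (simp add: powr_numeral)
    qed
    also have "\<dots> \<le> 1" using x by (simp add: lp_ball_def)
    also have "max 1 (2 / p) - 2 / p = 0" using False p by simp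
    then have "1 \<le> 2 * real n powr (max 1 (2 / p) - 2 / p)" using n by simp
    finally show ?thesis .
  qed
  then have "(\<Sum>i<n. (a i)\<^sup>2) * (\<Sum>i<n. (x i)\<^sup>2) \<le> (\<Sum>i<n. (a i)\<^sup>2) * (2 * real n powr (max 1 (2 / p) - 2 / p))"
    by (intro mult_left_mono) (auto intro: sum_nonneg)
  moreover have "(\<Sum>i<n. a i * x i)\<^sup>2 \<le> (\<Sum>i<n. (a i)\<^sup>2) * (\<Sum>i<n. (x i)\<^sup>2)"
    by (rule Cauchy_Schwarz_ineq_sum)
  ultimately show ?thesis by (simp add: powr_diff mult_ac)
qed

text \<open>The bound on the sum of absolute values is used directly; for \<open>p < 2\<close> this
  has a better order in \<open>n\<close> than the general bound by Cauchy-Schwarz.\<close>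

lemma lp_ball_sum_le:
  assumes p: "p \<ge> 1" and x: "x \<in> lp_ball p n" and n: "n \<ge> 1"
  shows "(\<Sum>i<n. x i)\<^sup>2 \<le> 4 * real n / real n powr (2 / p) * real n"
proof -
  have "\<bar>\<Sum>i<n. x i\<bar> \<le> (\<Sum>i<n. \<bar>x i\<bar>)" by (rule sum_abs)
  also have "\<dots> = (\<Sum>i<n. \<bar>x i\<bar> powr 1)" by simp
  also have "\<dots> \<le> 2 * real n powr (1 - 1 / p)" using p x n by (intro lp_ball_sum_powr_le) auto
  finally have "\<bar>\<Sum>i<n. x i\<bar>\<^sup>2 \<le> (2 * real n powr (1 - 1 / p))\<^sup>2" by (intro power_mono) auto
  also have "\<dots> = 4 * (real n powr (1 - 1 / p) * real n powr (1 - 1 / p))"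
    by (simp add: power2_eq_square)
  also have "real n powr (1 - 1 / p) * real n powr (1 - 1 / p) = real n powr (1 + 1 - 2 / p)"
    by (simp add: powr_add[symmetric])
  also have "\<dots> = real n * real n / real n powr (2 / p)"
    using n by (simp only: powr_diff powr_add) simp
  finally show ?thesis by simp
qed

section \<open>Norms of linear forms and the best constants\<close>

context
  fixes p :: real and n :: nat
  assumes p: "p \<ge> 1" and n: "n \<ge> 1"
begin

lemma p_pos: "p > 0"
  using p by simp

interpretation U: prob_space "uniform_lp_ball p n"
  by (rule prob_space_uniform_lp_ball[OF p_pos])

lemma abs_linear_le: "x \<in> lp_ball p n \<Longrightarrow> \<bar>\<Sum>i<n. a i * x i\<bar> \<le> (\<Sum>i<n. \<bar>a i\<bar>)"
proof -
  assume x: "x \<in> lp_ball p n"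
  have "\<bar>\<Sum>i<n. a i * x i\<bar> \<le> (\<Sum>i<n. \<bar>a i * x i\<bar>)" by (rule sum_abs)
  also have "\<dots> \<le> (\<Sum>i<n. \<bar>a i\<bar> * 1)"
    unfolding abs_mult using lp_ball_coordinate_le[OF p_pos x] by (intro sum_mono mult_left_mono) auto
  finally show ?thesis by simp
qed

lemma integrable_abs_powr:
  assumes "q \<ge> 0"
  shows "integrable (uniform_lp_ball p n) (\<lambda>x. \<bar>\<Sum>i<n. a i * x i\<bar> powr q)"
proof (rule U.integrable_const_bound)
  show "AE x in uniform_lp_ball p n. norm (\<bar>\<Sum>i<n. a i * x i\<bar> powr q) \<le> (\<Sum>i<n. \<bar>a i\<bar>) powr q"
    using AE_uniform_lp_ball
  proof eventually_elim
    case (elim x)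
    then show ?case using assms abs_linear_le[OF elim, of a] by (auto intro!: powr_mono2)
  qed
qed simp

lemma Lq_nonneg: "0 \<le> Lq_norm_lp_ball p q n a"
  by (simp add: Lq_norm_lp_ball_def)

lemma Lq_mono:
  assumes q: "1 \<le> q" "q \<le> r"
  shows "Lq_norm_lp_ball p q n a \<le> 2 * Lq_norm_lp_ball p r n a"
proof -
  let ?E = "\<lambda>q. LINT x|uniform_lp_ball p n. \<bar>\<Sum>i<n. a i * x i\<bar> powr q"
  have E0: "0 \<le> ?E q" for q by (intro Bochner_Integration.integral_nonneg) auto
  have L: "Lq_norm_lp_ball p q n a = ?E q powr (1 / q)" for q by (rule Lq_norm_lp_ball_eq[OF p_pos])
  \<comment> \<open>A strictly larger \<open>N\<close> is used because the norm may be 0 while the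
    comparison divides by \<open>N\<close>; letting \<open>N\<close> decrease to the norm finishes
    the proof.\<close>
  have "Lq_norm_lp_ball p q n a / 2 \<le> N" if N: "Lq_norm_lp_ball p r n a < N" for N
  proof -
    have N0: "N > 0" using N Lq_nonneg[of r a] by linarith
    have "?E r = (?E r powr (1 / r)) powr r" using q E0[of r] by (simp add: powr_powr)
    also have "\<dots> \<le> N powr r" using N q unfolding L by (intro powr_mono2) auto
    finally have "?E q \<le> 2 * N powr q"
      using q N0 integrable_abs_powr[of q a] integrable_abs_powr[of r a]
        U.expectation_powr_le[of q r N "\<lambda>x. \<bar>\<Sum>i<n. a i * x i\<bar>"] by simp
    then have "?E q powr (1 / q) \<le> (2 * N powr q) powr (1 / q)" using q E0[of q] by (intro powr_mono2) auto
    also have "\<dots> = 2 powr (1 / q) * N" using q N0 by (simp add: powr_mult powr_powr)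
    also have "\<dots> \<le> 2 powr 1 * N" using q N0 by (intro mult_right_mono powr_mono) auto
    finally show ?thesis by (simp add: L)
  qed
  then have "Lq_norm_lp_ball p q n a / 2 \<le> Lq_norm_lp_ball p r n a" by (rule dense_ge)
  then show ?thesis by simp
qed

lemma Lq_even:
  assumes k: "k \<ge> 1"
  shows "Lq_norm_lp_ball p (real (2 * k)) n a =
    (LINT x|uniform_lp_ball p n. (\<Sum>i<n. a i * x i) ^ (2 * k)) powr (1 / real (2 * k))"
proof -
  have "k > 0" using k by simp
  then show ?thesis unfolding Lq_norm_lp_ball_eq[OF p_pos] by (simp only: abs_powr_even)
qed

lemma root_even_power: "\<Phi> \<ge> 0 \<Longrightarrow> k \<ge> 1 \<Longrightarrow> (\<Phi> ^ k) powr (1 / real (2 * k)) = sqrt \<Phi>"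
proof (cases "\<Phi> = 0")
  case False
  moreover assume "\<Phi> \<ge> 0" "k \<ge> 1"
  ultimately show ?thesis by (simp add: powr_realpow[symmetric] powr_powr powr_half_sqrt)
qed simp

lemma Lq_even_le:
  assumes "k \<ge> 1" "\<Phi> \<ge> 0" "(LINT x|uniform_lp_ball p n. (\<Sum>i<n. a i * x i) ^ (2 * k)) \<le> \<Phi> ^ k"
  shows "Lq_norm_lp_ball p (real (2 * k)) n a \<le> sqrt \<Phi>"
  unfolding Lq_even[OF assms(1)] root_even_power[OF assms(2,1), symmetric] using assms(3)
  by (intro powr_mono2 Bochner_Integration.integral_nonneg) auto

lemma Lq_even_ge:
  assumes "k \<ge> 1" "\<Phi> \<ge> 0" "\<Phi> ^ k \<le> (LINT x|uniform_lp_ball p n. (\<Sum>i<n. a i * x i) ^ (2 * k))"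
  shows "sqrt \<Phi> \<le> Lq_norm_lp_ball p (real (2 * k)) n a"
  unfolding Lq_even[OF assms(1)] root_even_power[OF assms(2,1), symmetric] using assms(2,3)
  by (intro powr_mono2) auto

lemma Lq_le_of_bounded:
  assumes q: "q \<ge> 1" and B: "B \<ge> 0" "\<And>x. x \<in> lp_ball p n \<Longrightarrow> (\<Sum>i<n. a i * x i)\<^sup>2 \<le> B"
  shows "Lq_norm_lp_ball p q n a \<le> sqrt B"
proof -
  have "(LINT x|uniform_lp_ball p n. \<bar>\<Sum>i<n. a i * x i\<bar> powr q) \<le> (LINT x|uniform_lp_ball p n. sqrt B powr q)"
  proof (rule integral_mono_AE)
    show "AE x in uniform_lp_ball p n. \<bar>\<Sum>i<n. a i * x i\<bar> powr q \<le> sqrt B powr q"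
      using AE_uniform_lp_ball
    proof eventually_elim
      case (elim x)
      have "\<bar>\<Sum>i<n. a i * x i\<bar> \<le> sqrt B" using B(2)[OF elim] by (intro real_le_rsqrt) simp
      then show ?case using q by (intro powr_mono2) auto
    qed
  qed (use q in \<open>auto intro!: integrable_abs_powr\<close>)
  also have "\<dots> = sqrt B powr q" by (simp add: U.prob_space)
  finally have "Lq_norm_lp_ball p q n a \<le> (sqrt B powr q) powr (1 / q)"
    unfolding Lq_norm_lp_ball_eq[OF p_pos] using q
    by (intro powr_mono2 Bochner_Integration.integral_nonneg) auto
  then show ?thesis using q B by (simp add: powr_powr)
qed

text \<open>For \<open>q \<le> n\<close> pass to the next even exponent; for \<open>q > n\<close>
  the pointwise bound takes over. The factor 4 is the square of the 2 lost in
  \<open>Lq_mono\<close>.\<close>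

lemma Lq_upper:
  assumes q: "q \<ge> 1" and C: "C \<ge> 0" and e: "0 \<le> e" and s: "s \<ge> 0"
    and mom: "\<And>k. k \<le> n \<Longrightarrow> (LINT x|uniform_lp_ball p n. (\<Sum>i<n. a i * x i) ^ (2 * k)) \<le>
      (C * real k powr e / real n powr (2 / p) * s) ^ k"
    and bdd: "\<And>x. x \<in> lp_ball p n \<Longrightarrow> (\<Sum>i<n. a i * x i)\<^sup>2 \<le> C * real n powr e / real n powr (2 / p) * s"
  shows "Lq_norm_lp_ball p q n a \<le> sqrt (4 * C * (min q (real n) powr e / real n powr (2 / p)) * s)"
proof (cases "q \<le> real n")
  case True
  \<comment> \<open>The least \<open>k\<close> with \<open>q \<le> 2 * k\<close>. It satisfies
    \<open>k \<le> q\<close>: it is 1 if \<open>q \<le> 2\<close>, and otherwise at most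
    \<open>q / 2 + 1 \<le> q\<close>.\<close>
  define k where "k = nat \<lceil>q / 2\<rceil>"
  have k: "k \<ge> 1" "real k \<le> q" "q \<le> real (2 * k)" "k \<le> n"
  proof -
    have *: "real k = of_int \<lceil>q / 2\<rceil>" using q by (simp add: k_def)
    show "k \<ge> 1" using q by (simp add: k_def le_nat_iff)
    show kq: "real k \<le> q"
    proof (cases "q \<le> 2")
      case True
      then have "\<lceil>q / 2\<rceil> = 1" using q by (intro ceiling_unique) auto
      then show ?thesis using q * by simp
    next
      case False
      then show ?thesis using of_int_ceiling_le_add_one[of "q / 2"] unfolding * by linarith
    qed
    show "q \<le> real (2 * k)" using le_of_int_ceiling[of "q / 2"] unfolding of_nat_mult * by linarith
    show "k \<le> n" using kq True by linarith
  qed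
  have "Lq_norm_lp_ball p q n a \<le> 2 * Lq_norm_lp_ball p (real (2 * k)) n a"
    using q k by (intro Lq_mono) auto
  also have "\<dots> \<le> 2 * sqrt (C * real k powr e / real n powr (2 / p) * s)"
    using k C s by (intro mult_left_mono Lq_even_le mom) auto
  also have "\<dots> \<le> 2 * sqrt (C * q powr e / real n powr (2 / p) * s)"
    using k C s e by (intro mult_left_mono real_sqrt_le_mono mult_right_mono divide_right_mono powr_mono2) auto
  also have "\<dots> = sqrt (4 * (C * q powr e / real n powr (2 / p) * s))"
  proof -
    have "2 * sqrt X = sqrt (4 * X)" for X by (simp add: real_sqrt_mult)
    then show ?thesis .
  qed
  finally show ?thesis using True by (simp add: mult_ac)
next
  case False
  have "Lq_norm_lp_ball p q n a \<le> sqrt (C * real n powr e / real n powr (2 / p) * s)"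
    using q C s bdd by (intro Lq_le_of_bounded) auto
  also have "\<dots> \<le> sqrt (4 * (C * real n powr e / real n powr (2 / p) * s))"
  proof -
    have "0 \<le> C * real n powr e / real n powr (2 / p) * s" using C s by simp
    then show ?thesis by (intro real_sqrt_le_mono) linarith
  qed
  finally show ?thesis using False by (simp add: mult_ac)
qed

text \<open>The constants are \<open>41472 = 16 * 2592\<close> and \<open>4608 = 36 * 32 * 4\<close>: the second moment is bounded from
  below and the fourth from above, with \<open>2 powr max 1 (2 / p) \<le> 4\<close>.\<close>
lemma L1_lower:
  "sqrt ((1 / 41472) ^ 3 / (8 * 4608\<^sup>2) / real n powr (2 / p) * (\<Sum>i<n. (a i)\<^sup>2)) \<le> Lq_norm_lp_ball p 1 n a"
proof (cases "(\<Sum>i<n. (a i)\<^sup>2) = 0")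
  case True
  then show ?thesis by (simp only: True) (simp add: Lq_nonneg)
next
  case False
  define s where "s = (\<Sum>i<n. (a i)\<^sup>2)"
  define \<nu> where "\<nu> = 1 / real n powr (2 / p)"
  let ?T = "\<lambda>x. \<bar>\<Sum>i<n. a i * x i\<bar>"
  have s: "s > 0" using False by (simp add: s_def sum_nonneg order.strict_iff_order)
  have \<nu>: "\<nu> > 0" using n by (simp add: \<nu>_def)
  have int: "integrable (uniform_lp_ball p n) (\<lambda>x. ?T x ^ k)" if "k \<ge> 1" for k
  proof -
    have "?T x powr real k = ?T x ^ k" for x
      using that by (cases "?T x = 0") (simp_all only: powr_realpow powr_0 zero_less_abs_iff, auto simp: powr_realpow)
    then show ?thesis using integrable_abs_powr[of "real k" a] by simp
  qed
  have "(1 / 16 * (1 / 2592 * real 1 powr min 1 (2 / p) * s) / real n powr (2 / p)) ^ 1 \<le>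
    (LINT x|uniform_lp_ball p n. (\<Sum>i<n. a i * x i) ^ (2 * 1))"
    unfolding s_def using n
    by (intro uniform_lp_ball_moment_ge[OF p n] gen_normal_sum_moment_general[OF p n]) (auto intro: sum_nonneg)
  then have A: "1 / 41472 * \<nu> * s \<le> (LINT x|uniform_lp_ball p n. ?T x ^ 2)"
    by (simp add: \<nu>_def)
  have "(LINT x|uniform_lp_ball p n. (\<Sum>i<n. a i * x i) ^ (2 * 2)) \<le>
    (36 * (32 * real 2 powr max 1 (2 / p) * s) / real n powr (2 / p)) ^ 2"
    unfolding s_def by (intro uniform_lp_ball_moment_le[OF p n] gen_normal_sum_moment_general[OF p n])
  also have "\<dots> \<le> (36 * (32 * 4 * s) / real n powr (2 / p)) ^ 2"
  proof -
    have "real 2 powr max 1 (2 / p) \<le> real 2 powr 2" using p by (intro powr_mono) (auto simp: field_simps)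
    then have "real 2 powr max 1 (2 / p) \<le> 4" by simp
    then show ?thesis using s by (intro power_mono divide_right_mono mult_left_mono mult_right_mono) auto
  qed
  finally have B: "(LINT x|uniform_lp_ball p n. ?T x ^ 4) \<le> (4608 * \<nu> * s)\<^sup>2"
    by (simp add: \<nu>_def power_even_abs)
  have "(1 / 41472 * \<nu> * s) ^ 3 / (8 * (4608 * \<nu> * s)\<^sup>2) \<le> (LINT x|uniform_lp_ball p n. ?T x)\<^sup>2"
    using A B s \<nu> int[of 1] int[of 2] int[of 4] by (intro U.expectation_ge_of_moments) auto
  \<comment> \<open>The quotient is homogeneous of degree \<open>3 - 2 = 1\<close> in
    \<open>\<nu> * s\<close>, so the numerical constants separate.\<close>
  also have "(1 / 41472 * \<nu> * s) ^ 3 / (8 * (4608 * \<nu> * s)\<^sup>2) =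
      (1 / 41472) ^ 3 / (8 * 4608\<^sup>2) * ((\<nu> * s) ^ 3 / (\<nu> * s)\<^sup>2)"
    by (simp only: power_mult_distrib times_divide_times_eq mult_ac)
  also have "(\<nu> * s) ^ 3 / (\<nu> * s)\<^sup>2 = \<nu> * s" using s \<nu> by (simp add: power2_eq_square power3_eq_cube)
  finally have "sqrt ((1 / 41472) ^ 3 / (8 * 4608\<^sup>2) * (\<nu> * s)) \<le> (LINT x|uniform_lp_ball p n. ?T x)"
    by (intro real_le_lsqrt Bochner_Integration.integral_nonneg) auto
  also have "\<dots> = Lq_norm_lp_ball p 1 n a"
    unfolding Lq_norm_lp_ball_eq[OF p_pos] by (simp add: Bochner_Integration.integral_nonneg)
  finally show ?thesis by (simp add: s_def \<nu>_def)
qed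

text \<open>If \<open>t = min q n\<close> is at least 2, an even exponent not exceeding
  \<open>t\<close> is available; below 2 the first moment suffices because
  \<open>t powr e \<le> 4\<close>. In the first case \<open>64 = 4 * 16\<close>, with 4 from
  \<open>Lq_mono\<close> under the root and 16 from \<open>4 powr e\<close>; in the second
  \<open>128 = 8 * 4 * 4\<close>.\<close>

lemma Lq_lower:
  assumes q: "q \<ge> 1" and c: "c \<ge> 0" and e: "0 \<le> e" "e \<le> 2"
    and mom: "\<And>k. k \<le> n \<Longrightarrow> (c * real k powr e / real n powr (2 / p) * (\<Sum>i<n. (a i)\<^sup>2)) ^ k \<le>
      (LINT x|uniform_lp_ball p n. (\<Sum>i<n. a i * x i) ^ (2 * k))"
  shows "sqrt (min (c / 64) ((1 / 41472) ^ 3 / (128 * 4608\<^sup>2)) * (min q (real n) powr e / real n powr (2 / p)) *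
      (\<Sum>i<n. (a i)\<^sup>2)) \<le> Lq_norm_lp_ball p q n a"
proof -
  define s where "s = (\<Sum>i<n. (a i)\<^sup>2)"
  define t where "t = min q (real n)"
  define \<kappa> :: real where "\<kappa> = (1 / 41472) ^ 3 / (8 * 4608\<^sup>2)"
  have s: "s \<ge> 0" by (simp add: s_def sum_nonneg)
  have t: "t \<ge> 1" using q n by (simp add: t_def)
  have 4: "4 powr e \<le> (16::real)" using powr_mono[of e 2 "4::real"] e by simp
  have "sqrt (min (c / 64) (\<kappa> / 16) * (t powr e / real n powr (2 / p)) * s) \<le> Lq_norm_lp_ball p q n a"
  proof (cases "t \<ge> 2")
    case True
    \<comment> \<open>The largest \<open>k\<close> with \<open>2 * k \<le> t\<close>; since
      \<open>k \<ge> 1\<close>, rounding down still leaves \<open>k \<ge> t / 4\<close>.\<close>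
    define k where "k = nat \<lfloor>t / 2\<rfloor>"
    have k: "k \<ge> 1" "t / 4 \<le> real k" "real (2 * k) \<le> t"
    proof -
      have *: "real k = of_int \<lfloor>t / 2\<rfloor>" using True by (simp add: k_def)
      show k1: "k \<ge> 1" using True by (simp add: k_def le_nat_iff le_floor_iff)
      have "t / 2 < real k + 1" unfolding * by linarith
      then show "t / 4 \<le> real k" using k1 by linarith
      show "real (2 * k) \<le> t" using of_int_floor_le[of "t / 2"] unfolding of_nat_mult * by linarith
    qed
    then have kn: "k \<le> n" "real (2 * k) \<le> q" by (auto simp: t_def)
    have "sqrt (min (c / 64) (\<kappa> / 16) * (t powr e / real n powr (2 / p)) * s) \<le>
        sqrt (c / 64 * (t powr e / real n powr (2 / p)) * s)"
      using s by (intro real_sqrt_le_mono mult_right_mono) auto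
    also have "\<dots> \<le> sqrt (1 / 4 * (c * real k powr e / real n powr (2 / p) * s))"
    proof -
      have "t powr e = 4 powr e * (t / 4) powr e" using t by (simp add: powr_divide)
      also have "\<dots> \<le> 16 * real k powr e" using 4 k t e by (intro mult_mono powr_mono2) auto
      finally have "c / 64 * (t powr e / real n powr (2 / p)) * s \<le> c / 64 * (16 * real k powr e / real n powr (2 / p)) * s"
        using c s by (intro mult_right_mono mult_left_mono divide_right_mono) auto
      then show ?thesis by (intro real_sqrt_le_mono) simp
    qed
    also have "\<dots> = 1 / 2 * sqrt (c * real k powr e / real n powr (2 / p) * s)"
      by (simp only: real_sqrt_mult) (simp add: real_sqrt_divide)
    also have "\<dots> \<le> 1 / 2 * Lq_norm_lp_ball p (real (2 * k)) n a"
      using k kn c s mom[OF kn(1)] by (intro mult_left_mono Lq_even_ge) (auto simp: s_def)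
    also have "\<dots> \<le> Lq_norm_lp_ball p q n a"
      using Lq_mono[of "real (2 * k)" q a] k kn by simp
    finally show ?thesis .
  next
    case False
    have "t powr e \<le> 4"
    proof -
      have "t powr e \<le> 2 powr e" using False t e by (intro powr_mono2) auto
      also have "\<dots> \<le> 2 powr 2" using e by (intro powr_mono) auto
      finally show ?thesis by simp
    qed
    then have "min (c / 64) (\<kappa> / 16) * (t powr e / real n powr (2 / p)) * s \<le> \<kappa> / 16 * (4 / real n powr (2 / p)) * s"
      using s c by (intro mult_right_mono mult_mono divide_right_mono) (auto simp: \<kappa>_def)
    then have "sqrt (min (c / 64) (\<kappa> / 16) * (t powr e / real n powr (2 / p)) * s) \<le>
        sqrt (1 / 4 * (\<kappa> / real n powr (2 / p) * s))"
      by (intro real_sqrt_le_mono) simp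
    also have "\<dots> = 1 / 2 * sqrt (\<kappa> / real n powr (2 / p) * s)"
      by (simp only: real_sqrt_mult) (simp add: real_sqrt_divide)
    also have "\<dots> \<le> 1 / 2 * Lq_norm_lp_ball p 1 n a"
      using L1_lower[of a] by (intro mult_left_mono) (simp_all add: \<kappa>_def s_def)
    also have "\<dots> \<le> Lq_norm_lp_ball p q n a" using Lq_mono[of 1 q a] q by simp
    finally show ?thesis .
  qed
  then show ?thesis by (simp add: s_def t_def \<kappa>_def)
qed

end

section \<open>Best constants as attained extrema\<close>

text \<open>\<open>GREATEST\<close> is meaningful only if a maximum exists. The admissible set
  contains \<open>c\<close>, is bounded by means of \<open>a0\<close>, and contains its supremum
  because each vector imposes a closed condition on \<open>A\<close>.\<close>

lemma best_lower_bounds: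
  fixes a0 :: "nat \<Rightarrow> real"
  assumes lower: "\<And>a. c * sqrt (\<Sum>i<n. (a i)\<^sup>2) \<le> Lq_norm_lp_ball p q n a"
    and a0: "(\<Sum>i<n. (a0 i)\<^sup>2) > 0"
  shows "c \<le> best_lower p q n"
    and "\<And>a. best_lower p q n * sqrt (\<Sum>i<n. (a i)\<^sup>2) \<le> Lq_norm_lp_ball p q n a"
proof -
  define S where "S = {A. \<forall>a. A * sqrt (\<Sum>i<n. (a i)\<^sup>2) \<le> Lq_norm_lp_ball p q n a}"
  have "c \<in> S" using lower by (simp add: S_def)
  have bdd: "bdd_above S"
  proof (rule bdd_aboveI)
    fix A assume "A \<in> S"
    then have "A * sqrt (\<Sum>i<n. (a0 i)\<^sup>2) \<le> Lq_norm_lp_ball p q n a0" by (simp add: S_def)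
    then show "A \<le> Lq_norm_lp_ball p q n a0 / sqrt (\<Sum>i<n. (a0 i)\<^sup>2)"
      using a0 by (simp add: pos_le_divide_eq)
  qed
  have "Sup S * sqrt (\<Sum>i<n. (a i)\<^sup>2) \<le> Lq_norm_lp_ball p q n a" for a
  proof (cases "sqrt (\<Sum>i<n. (a i)\<^sup>2) = 0")
    case True
    then show ?thesis unfolding True by (simp add: Lq_norm_lp_ball_def)
  next
    case False
    then have pos: "sqrt (\<Sum>i<n. (a i)\<^sup>2) > 0"
      by (simp add: order.strict_iff_order sum_nonneg)
    have "Sup S \<le> Lq_norm_lp_ball p q n a / sqrt (\<Sum>i<n. (a i)\<^sup>2)"
      using \<open>c \<in> S\<close> pos by (intro cSup_least) (auto simp: S_def pos_le_divide_eq)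
    then show ?thesis using pos by (simp add: pos_le_divide_eq)
  qed
  then have mem: "Sup S \<in> S" by (simp add: S_def)
  have "best_lower p q n = Sup S"
    unfolding best_lower_def
    using mem cSup_upper[OF _ bdd] by (intro Greatest_equality) (auto simp: S_def)
  then show "c \<le> best_lower p q n"
    "\<And>a. best_lower p q n * sqrt (\<Sum>i<n. (a i)\<^sup>2) \<le> Lq_norm_lp_ball p q n a"
    using mem cSup_upper[OF \<open>c \<in> S\<close> bdd] by (auto simp: S_def)
qed

lemma best_upper_bounds:
  fixes a0 :: "nat \<Rightarrow> real"
  assumes upper: "\<And>a. Lq_norm_lp_ball p q n a \<le> C * sqrt (\<Sum>i<n. (a i)\<^sup>2)"
    and a0: "(\<Sum>i<n. (a0 i)\<^sup>2) > 0"
  shows "best_upper p q n \<le> C"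
    and "\<And>a. Lq_norm_lp_ball p q n a \<le> best_upper p q n * sqrt (\<Sum>i<n. (a i)\<^sup>2)"
proof -
  define S where "S = {B. \<forall>a. Lq_norm_lp_ball p q n a \<le> B * sqrt (\<Sum>i<n. (a i)\<^sup>2)}"
  have "C \<in> S" using upper by (simp add: S_def)
  have bdd: "bdd_below S"
  proof (rule bdd_belowI)
    fix B assume "B \<in> S"
    then have "Lq_norm_lp_ball p q n a0 \<le> B * sqrt (\<Sum>i<n. (a0 i)\<^sup>2)" by (simp add: S_def)
    then show "Lq_norm_lp_ball p q n a0 / sqrt (\<Sum>i<n. (a0 i)\<^sup>2) \<le> B"
      using a0 by (simp add: pos_divide_le_eq)
  qed
  have "Lq_norm_lp_ball p q n a \<le> Inf S * sqrt (\<Sum>i<n. (a i)\<^sup>2)" for a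
  proof (cases "sqrt (\<Sum>i<n. (a i)\<^sup>2) = 0")
    case True
    \<comment> \<open>On such a vector the assumed upper estimate forces the norm to be at most 0,
      so the value of the constant is immaterial.\<close>
    then show ?thesis using upper[of a] unfolding True by simp
  next
    case False
    then have pos: "sqrt (\<Sum>i<n. (a i)\<^sup>2) > 0"
      by (simp add: order.strict_iff_order sum_nonneg)
    have "Lq_norm_lp_ball p q n a / sqrt (\<Sum>i<n. (a i)\<^sup>2) \<le> Inf S"
      using \<open>C \<in> S\<close> pos by (intro cInf_greatest) (auto simp: S_def pos_divide_le_eq)
    then show ?thesis using pos by (simp add: pos_divide_le_eq)
  qed
  then have mem: "Inf S \<in> S" by (simp add: S_def)
  have "best_upper p q n = Inf S"
    unfolding best_upper_def
    using mem cInf_lower[OF _ bdd] by (intro Least_equality) (auto simp: S_def)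
  then show "best_upper p q n \<le> C"
    "\<And>a. Lq_norm_lp_ball p q n a \<le> best_upper p q n * sqrt (\<Sum>i<n. (a i)\<^sup>2)"
    using mem cInf_lower[OF \<open>C \<in> S\<close> bdd] by (auto simp: S_def)
qed

text \<open>With \<open>t = min q n\<close>, the value \<open>e = 1\<close> gives
  \<open>sqrt t / n powr (1 / p)\<close> and \<open>e = 2 / p\<close> gives
  \<open>(t / n) powr (1 / p)\<close>, the two expressions to be compared with the best constants.
  The exponent stands under the root, as in the moment bounds.\<close>

definition rate :: "real \<Rightarrow> real \<Rightarrow> nat \<Rightarrow> real \<Rightarrow> real" where
  "rate p q n e = sqrt (min q (real n) powr e / real n powr (2 / p))"

lemma rate_1:
  assumes "p \<ge> 1" "q \<ge> 1" "n \<ge> 1"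
  shows "rate p q n 1 = sqrt q / real n powr (1 / p) * min 1 (sqrt (real n / q))"
proof -
  have "real n powr (2 / p) = (real n powr (1 / p))\<^sup>2"
    using assms by (simp add: power2_eq_square powr_add[symmetric])
  then have "rate p q n 1 = sqrt (min q (real n)) / real n powr (1 / p)"
    using assms by (simp add: rate_def real_sqrt_divide min_def)
  also have "sqrt (min q (real n)) = sqrt q * min 1 (sqrt (real n / q))"
    using assms by (auto simp: min_def real_sqrt_divide field_simps)
  finally show ?thesis by simp
qed

lemma rate_2_div_p:
  assumes "p \<ge> 1" "q \<ge> 1" "n \<ge> 1"
  shows "rate p q n (2 / p) = min 1 ((q / real n) powr (1 / p))"
proof -
  have "rate p q n (2 / p) = sqrt ((min q (real n) / real n) powr (2 / p))"
    using assms by (simp add: rate_def powr_divide)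
  also have "(min q (real n) / real n) powr (2 / p) = ((min q (real n) / real n) powr (1 / p))\<^sup>2"
    using assms by (simp add: power2_eq_square powr_add[symmetric])
  also have "sqrt \<dots> = (min q (real n) / real n) powr (1 / p)" by simp
  also have "\<dots> = min 1 ((q / real n) powr (1 / p))"
  proof (cases "q \<le> real n")
    case True
    then have "(q / real n) powr (1 / p) \<le> 1" using assms by (intro powr_le1) auto
    then show ?thesis using True by simp
  next
    case False
    then have "1 \<le> (q / real n) powr (1 / p)" using assms by (intro ge_one_powr_ge_zero) auto
    then show ?thesis using False assms by simp
  qed
  finally show ?thesis .
qed

text \<open>The moment estimates for the ball are those for the independent variables with the constants
  divided by 16 or multiplied by 36: \<open>165888 = 16 * 10368\<close> is the worst of the lower bounds, and
  \<open>9216 = 36 * 256\<close> of the upper bounds, both for the vector of ones.\<close>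
lemma best_constant_bounds:
  obtains c C :: real where "c > 0" "C > 0"
    and "\<And>p q n. p \<ge> 1 \<Longrightarrow> q \<ge> 1 \<Longrightarrow> n \<ge> 1 \<Longrightarrow>
      c * rate p q n (min 1 (2 / p)) \<le> best_lower p q n \<and>
      best_lower p q n \<le> C * rate p q n 1 \<and> best_lower p q n \<le> C * rate p q n (2 / p) \<and>
      c * rate p q n 1 \<le> best_upper p q n \<and> c * rate p q n (2 / p) \<le> best_upper p q n \<and>
      best_upper p q n \<le> C * rate p q n (max 1 (2 / p))"
proof
  \<comment> \<open>The smaller alternative of \<open>Lq_lower\<close> at the weakest moment
    constant, so that one \<open>c\<close> serves all vectors.\<close>
  define c :: real where "c = min (1 / 165888 / 64) ((1 / 41472) ^ 3 / (128 * 4608\<^sup>2))"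
  have cle: "c \<le> min (b / 64) ((1 / 41472) ^ 3 / (128 * 4608\<^sup>2))" if "b \<ge> 1 / 165888" for b
    unfolding c_def using that by (intro min.mono) auto
  have c0: "c > 0" by (simp add: c_def)
  show "sqrt c > 0" "sqrt (4 * 9216) > (0::real)" using c0 by simp_all
  fix p q :: real and n :: nat
  assume p: "p \<ge> 1" and q: "q \<ge> 1" and n: "n \<ge> 1"
  let ?u = "\<lambda>i::nat. if i = 0 then 1 else 0 :: real"
  have u: "(\<Sum>i<n. (?u i)\<^sup>2) = 1" "(\<Sum>i<n. ?u i * x i) = x 0" for x
    using n by (simp_all add: if_distrib[of "\<lambda>u. u * _"] if_distrib[of "\<lambda>u. u ^ 2"] cong: if_cong)
  have "\<bar>2 / p\<bar> \<le> 2" using p by (simp add: divide_le_eq)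
  then have e: "2 / p \<le> 2" "0 \<le> 2 / p" using p by auto
  have lower: "sqrt c * rate p q n e * sqrt (\<Sum>i<n. (a i)\<^sup>2) \<le> Lq_norm_lp_ball p q n a"
    if "b \<ge> 1 / 165888" "0 \<le> e" "e \<le> 2"
      and "\<And>k. k \<le> n \<Longrightarrow> (b * real k powr e / real n powr (2 / p) * (\<Sum>i<n. (a i)\<^sup>2)) ^ k \<le>
        (LINT x|uniform_lp_ball p n. (\<Sum>i<n. a i * x i) ^ (2 * k))" for a b e
  proof -
    have "sqrt c * rate p q n e * sqrt (\<Sum>i<n. (a i)\<^sup>2) =
        sqrt (c * (min q (real n) powr e / real n powr (2 / p)) * (\<Sum>i<n. (a i)\<^sup>2))"
      by (simp only: rate_def real_sqrt_mult)
    also have "\<dots> \<le> sqrt (min (b / 64) ((1 / 41472) ^ 3 / (128 * 4608\<^sup>2)) *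
        (min q (real n) powr e / real n powr (2 / p)) * (\<Sum>i<n. (a i)\<^sup>2))"
      by (intro real_sqrt_le_mono mult_right_mono cle that) (auto intro: sum_nonneg)
    also have "\<dots> \<le> Lq_norm_lp_ball p q n a"
      using that by (intro Lq_lower[OF p n q]) auto
    finally show ?thesis .
  qed
  have upper: "Lq_norm_lp_ball p q n a \<le> sqrt (4 * 9216) * rate p q n e * sqrt (\<Sum>i<n. (a i)\<^sup>2)"
    if "B \<le> 9216" "0 \<le> e"
      and "\<And>k. k \<le> n \<Longrightarrow> (LINT x|uniform_lp_ball p n. (\<Sum>i<n. a i * x i) ^ (2 * k)) \<le>
        (B * real k powr e / real n powr (2 / p) * (\<Sum>i<n. (a i)\<^sup>2)) ^ k"
      and "\<And>x. x \<in> lp_ball p n \<Longrightarrow> (\<Sum>i<n. a i * x i)\<^sup>2 \<le> B * real n powr e / real n powr (2 / p) * (\<Sum>i<n. (a i)\<^sup>2)"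
      and "0 \<le> B" for a B e
  proof -
    have "Lq_norm_lp_ball p q n a \<le> sqrt (4 * B * (min q (real n) powr e / real n powr (2 / p)) * (\<Sum>i<n. (a i)\<^sup>2))"
      using that by (intro Lq_upper[OF p n q]) (auto intro: sum_nonneg)
    also have "\<dots> \<le> sqrt (4 * 9216 * (min q (real n) powr e / real n powr (2 / p)) * (\<Sum>i<n. (a i)\<^sup>2))"
      using that by (intro real_sqrt_le_mono mult_right_mono) (auto intro: sum_nonneg)
    also have "\<dots> = sqrt (4 * 9216) * rate p q n e * sqrt (\<Sum>i<n. (a i)\<^sup>2)"
      by (simp only: rate_def real_sqrt_mult)
    finally show ?thesis .
  qed
  have gl: "sqrt c * rate p q n (min 1 (2 / p)) * sqrt (\<Sum>i<n. (a i)\<^sup>2) \<le> Lq_norm_lp_ball p q n a" for a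
  proof (rule lower[of "1 / 41472"])
    fix k assume "k \<le> n"
    then show "(1 / 41472 * real k powr min 1 (2 / p) / real n powr (2 / p) * (\<Sum>i<n. (a i)\<^sup>2)) ^ k \<le>
        (LINT x|uniform_lp_ball p n. (\<Sum>i<n. a i * x i) ^ (2 * k))"
      using uniform_lp_ball_moment_ge[OF p n gen_normal_sum_moment_general(2)[OF p n, of k a]]
      by (simp add: sum_nonneg)
  qed (use e in auto)
  \<comment> \<open>The constant is \<open>1152 = 36 * 32\<close>, which also dominates the
    pointwise constant 2.\<close>
  have gu: "Lq_norm_lp_ball p q n a \<le> sqrt (4 * 9216) * rate p q n (max 1 (2 / p)) * sqrt (\<Sum>i<n. (a i)\<^sup>2)" for a
  proof (rule upper[of 1152])
    fix k
    show "(LINT x|uniform_lp_ball p n. (\<Sum>i<n. a i * x i) ^ (2 * k)) \<le>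
        (1152 * real k powr max 1 (2 / p) / real n powr (2 / p) * (\<Sum>i<n. (a i)\<^sup>2)) ^ k"
      using uniform_lp_ball_moment_le[OF p n gen_normal_sum_moment_general(1)[OF p n, of a k]] by (simp add: mult_ac)
  next
    fix x assume "x \<in> lp_ball p n"
    from lp_ball_linear_le[OF p this n, of a]
    show "(\<Sum>i<n. a i * x i)\<^sup>2 \<le> 1152 * real n powr max 1 (2 / p) / real n powr (2 / p) * (\<Sum>i<n. (a i)\<^sup>2)"
      by (rule order_trans) (intro mult_right_mono divide_right_mono, auto intro: sum_nonneg)
  qed auto
  have onesl: "sqrt c * rate p q n 1 * sqrt (\<Sum>i<n. 1\<^sup>2) \<le> Lq_norm_lp_ball p q n (\<lambda>_. 1)"
  proof (rule lower[of "1 / 165888"])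
    fix k assume "k \<le> n"
    then show "(1 / 165888 * real k powr 1 / real n powr (2 / p) * (\<Sum>i<n. 1\<^sup>2)) ^ k \<le>
        (LINT x|uniform_lp_ball p n. (\<Sum>i<n. 1 * x i) ^ (2 * k))"
      using uniform_lp_ball_moment_ge[OF p n gen_normal_sum_moment_ones(2)[OF p n, of k]] by (simp add: mult_ac)
  qed auto
  have onesu: "Lq_norm_lp_ball p q n (\<lambda>_. 1) \<le> sqrt (4 * 9216) * rate p q n 1 * sqrt (\<Sum>i<n. 1\<^sup>2)"
  proof (rule upper[of 9216])
    fix k assume "k \<le> n"
    then show "(LINT x|uniform_lp_ball p n. (\<Sum>i<n. 1 * x i) ^ (2 * k)) \<le>
        (9216 * real k powr 1 / real n powr (2 / p) * (\<Sum>i<n. 1\<^sup>2)) ^ k"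
      using uniform_lp_ball_moment_le[OF p n gen_normal_sum_moment_ones(1)[OF p n, of k]] by (simp add: mult_ac)
  next
    fix x assume "x \<in> lp_ball p n"
    from lp_ball_sum_le[OF p this n]
    have "(\<Sum>i<n. x i)\<^sup>2 \<le> 9216 * real n / real n powr (2 / p) * real n"
      by (rule order_trans) (intro mult_right_mono divide_right_mono, auto)
    then show "(\<Sum>i<n. 1 * x i)\<^sup>2 \<le> 9216 * real n powr 1 / real n powr (2 / p) * (\<Sum>i<n. 1\<^sup>2)"
      by simp
  qed auto
  \<comment> \<open>The first coordinate alone: \<open>20736 = 16 * 1296\<close>, from the lower
    bound for one variable.\<close>
  have unitl: "sqrt c * rate p q n (2 / p) * sqrt (\<Sum>i<n. (?u i)\<^sup>2) \<le> Lq_norm_lp_ball p q n ?u"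
  proof (rule lower[of "1 / 20736"])
    fix k assume "k \<le> n"
    moreover have "(1 / 1296 * real k powr (2 / p)) ^ k \<le> gen_normal_sum_moment p n ?u k"
      unfolding gen_normal_sum_moment_unit[OF p n] by (rule gen_normal_moment_lower[OF p])
    ultimately show "(1 / 20736 * real k powr (2 / p) / real n powr (2 / p) * (\<Sum>i<n. (?u i)\<^sup>2)) ^ k \<le>
        (LINT x|uniform_lp_ball p n. (\<Sum>i<n. ?u i * x i) ^ (2 * k))"
      unfolding u using uniform_lp_ball_moment_ge[OF p n, of "1 / 1296 * real k powr (2 / p)" k ?u] unfolding u by simp
  qed (use e in auto)
  \<comment> \<open>Likewise \<open>576 = 36 * 16\<close>; the pointwise bound is just
    \<open>\<bar>x 0\<bar> \<le> 1\<close>.\<close>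
  have unitu: "Lq_norm_lp_ball p q n ?u \<le> sqrt (4 * 9216) * rate p q n (2 / p) * sqrt (\<Sum>i<n. (?u i)\<^sup>2)"
  proof (rule upper[of 576])
    fix k
    have "gen_normal_sum_moment p n ?u k \<le> (16 * real k powr (2 / p)) ^ k"
      unfolding gen_normal_sum_moment_unit[OF p n] by (rule gen_normal_moment_upper[OF p])
    then show "(LINT x|uniform_lp_ball p n. (\<Sum>i<n. ?u i * x i) ^ (2 * k)) \<le>
        (576 * real k powr (2 / p) / real n powr (2 / p) * (\<Sum>i<n. (?u i)\<^sup>2)) ^ k"
      unfolding u using uniform_lp_ball_moment_le[OF p n, of ?u k "16 * real k powr (2 / p)"] unfolding u by simp
  next
    fix x assume "x \<in> lp_ball p n"
    then have "\<bar>x 0\<bar> \<le> 1" using p n by (intro lp_ball_coordinate_le) auto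
    then have "(x 0)\<^sup>2 \<le> 1" by (simp add: abs_square_le_1)
    then show "(\<Sum>i<n. ?u i * x i)\<^sup>2 \<le> 576 * real n powr (2 / p) / real n powr (2 / p) * (\<Sum>i<n. (?u i)\<^sup>2)"
      unfolding u using n by simp
  qed (use e in auto)
  have pos: "(\<Sum>i<n. (?u i)\<^sup>2) > 0" "sqrt (\<Sum>i<n. 1\<^sup>2) > 0" unfolding u using n by simp_all
  note bl = best_lower_bounds[OF gl pos(1)]
  note bu = best_upper_bounds[OF gu pos(1)]
  \<comment> \<open>Testing the extremal inequalities on the two special vectors bounds
    \<open>best_lower\<close> from above and \<open>best_upper\<close> from below; the common factor
    \<open>sqrt n\<close> of the vector of ones is cancelled at the end.\<close>
  have "best_lower p q n * sqrt (\<Sum>i<n. 1\<^sup>2) \<le> sqrt (4 * 9216) * rate p q n 1 * sqrt (\<Sum>i<n. 1\<^sup>2)"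
    using bl(2)[of "\<lambda>_. 1"] onesu by (rule order_trans)
  moreover have "sqrt c * rate p q n 1 * sqrt (\<Sum>i<n. 1\<^sup>2) \<le> best_upper p q n * sqrt (\<Sum>i<n. 1\<^sup>2)"
    using onesl bu(2)[of "\<lambda>_. 1"] by (rule order_trans)
  moreover have "best_lower p q n \<le> sqrt (4 * 9216) * rate p q n (2 / p)"
    using order_trans[OF bl(2)[of ?u] unitu] unfolding u by simp
  moreover have "sqrt c * rate p q n (2 / p) \<le> best_upper p q n"
    using order_trans[OF unitl bu(2)[of ?u]] unfolding u by simp
  ultimately show "sqrt c * rate p q n (min 1 (2 / p)) \<le> best_lower p q n \<and>
      best_lower p q n \<le> sqrt (4 * 9216) * rate p q n 1 \<and> best_lower p q n \<le> sqrt (4 * 9216) * rate p q n (2 / p) \<and>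
      sqrt c * rate p q n 1 \<le> best_upper p q n \<and> sqrt c * rate p q n (2 / p) \<le> best_upper p q n \<and>
      best_upper p q n \<le> sqrt (4 * 9216) * rate p q n (max 1 (2 / p))"
    using bl(1) bu(1) mult_right_le_imp_le[OF _ pos(2)] by blast
qed

text \<open>\<open>sim_on\<close> bounds the second function by multiples of the first, while the
  estimates here go the other way; the two constants are inverted and exchange their roles.\<close>

lemma sim_onI:
  assumes "c > 0" "C > 0" "\<And>t. t \<in> S \<Longrightarrow> c * g t \<le> f t \<and> f t \<le> C * g t"
  shows "sim_on S f g"
  unfolding sim_on_def
proof (intro exI conjI ballI)
  fix t assume "t \<in> S"
  then show "1 / C * f t \<le> g t" "g t \<le> 1 / c * f t"
    using assms(1,2) assms(3)[of t] by (auto simp: field_simps)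
qed (use assms in auto)

theorem theorem7:
  shows
    "sim_on {(p, q, n). 1 \<le> p \<and> p \<le> 2 \<and> 1 \<le> q \<and> 1 \<le> n}
       (\<lambda>(p, q, n). best_lower p q n)
       (\<lambda>(p, q, n). sqrt q / real n powr (1 / p) * min 1 (sqrt (real n / q))) \<and>
     sim_on {(p, q, n). 1 \<le> p \<and> p \<le> 2 \<and> 1 \<le> q \<and> 1 \<le> n}
       (\<lambda>(p, q, n). best_upper p q n)
       (\<lambda>(p, q, n). min 1 ((q / real n) powr (1 / p))) \<and>
     sim_on {(p, q, n). 2 < p \<and> 1 \<le> q \<and> 1 \<le> n}
       (\<lambda>(p, q, n). best_lower p q n)
       (\<lambda>(p, q, n). min 1 ((q / real n) powr (1 / p))) \<and>
     sim_on {(p, q, n). 2 < p \<and> 1 \<le> q \<and> 1 \<le> n}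
       (\<lambda>(p, q, n). best_upper p q n)
       (\<lambda>(p, q, n). sqrt q / real n powr (1 / p) * min 1 (sqrt (real n / q)))"
proof -
  obtain c C :: real where c: "c > 0" and C: "C > 0"
    and bounds: "\<And>p q n. p \<ge> 1 \<Longrightarrow> q \<ge> 1 \<Longrightarrow> n \<ge> 1 \<Longrightarrow>
      c * rate p q n (min 1 (2 / p)) \<le> best_lower p q n \<and>
      best_lower p q n \<le> C * rate p q n 1 \<and> best_lower p q n \<le> C * rate p q n (2 / p) \<and>
      c * rate p q n 1 \<le> best_upper p q n \<and> c * rate p q n (2 / p) \<le> best_upper p q n \<and>
      best_upper p q n \<le> C * rate p q n (max 1 (2 / p))"
    using best_constant_bounds by blast
  \<comment> \<open>For \<open>p \<le> 2\<close> the general bound on \<open>best_lower\<close>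
    meets that from the vector of ones, and the bound on \<open>best_upper\<close> meets that from
    the unit vector. For \<open>p > 2\<close> the two vectors exchange roles.\<close>
  have small: "min 1 (2 / p) = 1" "max 1 (2 / p) = 2 / p" if "1 \<le> p" "p \<le> 2" for p :: real
    using that by (simp_all add: min_def max_def)
  have large: "min 1 (2 / p) = 2 / p" "max 1 (2 / p) = 1" if "2 < p" for p :: real
    using that by (simp_all add: min_def max_def)
  show ?thesis
  proof (intro conjI)
    show "sim_on {(p, q, n). 1 \<le> p \<and> p \<le> 2 \<and> 1 \<le> q \<and> 1 \<le> n}
       (\<lambda>(p, q, n). best_lower p q n)
       (\<lambda>(p, q, n). sqrt q / real n powr (1 / p) * min 1 (sqrt (real n / q)))"
    proof (rule sim_onI[OF c C], clarify)
      fix p q :: real and n :: nat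
      assume "1 \<le> p" "p \<le> 2" "1 \<le> q" "1 \<le> n"
      then show "c * (sqrt q / real n powr (1 / p) * min 1 (sqrt (real n / q))) \<le> best_lower p q n \<and>
          best_lower p q n \<le> C * (sqrt q / real n powr (1 / p) * min 1 (sqrt (real n / q)))"
        using bounds[of p q n] small[of p] rate_1[of p q n] by auto
    qed
  next
    show "sim_on {(p, q, n). 1 \<le> p \<and> p \<le> 2 \<and> 1 \<le> q \<and> 1 \<le> n}
       (\<lambda>(p, q, n). best_upper p q n)
       (\<lambda>(p, q, n). min 1 ((q / real n) powr (1 / p)))"
    proof (rule sim_onI[OF c C], clarify)
      fix p q :: real and n :: nat
      assume "1 \<le> p" "p \<le> 2" "1 \<le> q" "1 \<le> n"
      then show "c * (min 1 ((q / real n) powr (1 / p))) \<le> best_upper p q n \<and>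
          best_upper p q n \<le> C * (min 1 ((q / real n) powr (1 / p)))"
        using bounds[of p q n] small[of p] rate_2_div_p[of p q n] by auto
    qed
  next
    show "sim_on {(p, q, n). 2 < p \<and> 1 \<le> q \<and> 1 \<le> n}
       (\<lambda>(p, q, n). best_lower p q n)
       (\<lambda>(p, q, n). min 1 ((q / real n) powr (1 / p)))"
    proof (rule sim_onI[OF c C], clarify)
      fix p q :: real and n :: nat
      assume "2 < p" "1 \<le> q" "1 \<le> n"
      then show "c * (min 1 ((q / real n) powr (1 / p))) \<le> best_lower p q n \<and>
          best_lower p q n \<le> C * (min 1 ((q / real n) powr (1 / p)))"
        using bounds[of p q n] large[of p] rate_2_div_p[of p q n] by auto
    qed
  next
    show "sim_on {(p, q, n). 2 < p \<and> 1 \<le> q \<and> 1 \<le> n}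
       (\<lambda>(p, q, n). best_upper p q n)
       (\<lambda>(p, q, n). sqrt q / real n powr (1 / p) * min 1 (sqrt (real n / q)))"
    proof (rule sim_onI[OF c C], clarify)
      fix p q :: real and n :: nat
      assume "2 < p" "1 \<le> q" "1 \<le> n"
      then show "c * (sqrt q / real n powr (1 / p) * min 1 (sqrt (real n / q))) \<le> best_upper p q n \<and>
          best_upper p q n \<le> C * (sqrt q / real n powr (1 / p) * min 1 (sqrt (real n / q)))"
        using bounds[of p q n] large[of p] rate_1[of p q n] by auto
    qed
  qed
qed

end
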